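(* There exists a universal constant $C>0$ such that the following holds for every $n$. Let $\mu$ be a centered Borel probability measure on $\mathbb{R}^n$ and let $\alpha,\beta\in(0,\infty)$. Assume that $\mathrm{Cov}_1(\mu)=\frac{\alpha}{\sqrt{n}}\,\mathrm{Id}$ and $$\int_{\mathbb{R}^n}\int_{\mathbb{R}^n}\frac{(x\cdot y)^4}{|x|^3|y|^3}\,d\mu(x)\,d\mu(y)\ \le\ \frac{\beta\alpha^2}{n}.$$ Then $$\mathrm{Var}(F_\mu)\ \le\ \frac{C(1+\beta)\alpha^2}{n^2}.$$
   Context: $x\cdot y$ and $|x|$ denote the Euclidean inner product and norm on $\mathbb{R}^n$. A probability measure $\mu$ on $\mathbb{R}^n$ is centered if it has finite first moment and $\int x\,d\mu(x)=0$. $\mathrm{Cov}_1(\mu)$ is the $n\times n$ matrix $\int_{\mathbb{R}^n} x\otimes x\,\frac{d\mu(x)}{|x|}$, with entries $\int x_ix_j/|x|\,d\mu(x)$. Integrands such as $x_ix_j/|x|$ and $(x\cdot y)^4/(|x|^3|y|^3)$ are taken to be $0$ where $x=0$ or $y=0$. $S^{n-1}$ is the Euclidean unit sphere and $\sigma_{n-1}$ the uniform (rotation-invariant) probability measure on it. For a probability measure $\mu$ with finite first moment, $F_\mu:S^{n-1}\to\mathbb{R}$ is $F_\mu(\theta)=\int_{\mathbb{R}^n}(x\cdot\theta)_+\,d\mu(x)$, where $t_+=\max\{t,0\}$. $\mathrm{Var}(F_\mu)$ is the variance of $F_\mu$ with respect to $\sigma_{n-1}$. *)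

theory Defs
  imports "HOL-Probability.Probability"
begin

text \<open>
  The dimension \<open>n\<close> is quantified inside a formula (below the universal constant), so it cannot
  be a type.  A vector of \<open>n\<close>-dimensional space is an element of \<open>{..<n} \<rightarrow>\<^sub>E UNIV\<close>, which is
  the underlying set of \<open>Rn n\<close>.  The product sigma-algebra of finitely many copies of \<open>borel\<close>
  is the Borel sigma-algebra.  The Euclidean norm of \<open>x\<close> is \<open>L2_set x {..<n}\<close> from the library.
\<close>

definition Rn :: "nat \<Rightarrow> (nat \<Rightarrow> real) measure" where
  "Rn n = PiM {..<n} (\<lambda>_. borel)"

abbreviation vnorm :: "nat \<Rightarrow> (nat \<Rightarrow> real) \<Rightarrow> real" where
  "vnorm n x \<equiv> L2_set x {..<n}"

definition vinner :: "nat \<Rightarrow> (nat \<Rightarrow> real) \<Rightarrow> (nat \<Rightarrow> real) \<Rightarrow> real" where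
  "vinner n x y = (\<Sum>i<n. x i * y i)"

text \<open>Only the sigma-algebra is constrained here; the measure carried by \<open>Rn n\<close> is irrelevant.\<close>

definition borel_prob :: "nat \<Rightarrow> (nat \<Rightarrow> real) measure \<Rightarrow> bool" where
  "borel_prob n \<mu> \<longleftrightarrow> sets \<mu> = sets (Rn n) \<and> prob_space \<mu>"

definition centered :: "nat \<Rightarrow> (nat \<Rightarrow> real) measure \<Rightarrow> bool" where
  "centered n \<mu> \<longleftrightarrow> integrable \<mu> (vnorm n) \<and> (\<forall>i<n. (\<integral>x. x i \<partial>\<mu>) = 0)"

text \<open>The integrand is \<open>0\<close> at \<open>x = 0\<close> because \<open>a / 0 = 0\<close>.\<close>

definition Cov1 :: "nat \<Rightarrow> (nat \<Rightarrow> real) measure \<Rightarrow> nat \<Rightarrow> nat \<Rightarrow> real" where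
  "Cov1 n \<mu> i j = (\<integral>x. x i * x j / vnorm n x \<partial>\<mu>)"

definition Fmu :: "nat \<Rightarrow> (nat \<Rightarrow> real) measure \<Rightarrow> (nat \<Rightarrow> real) \<Rightarrow> real" where
  "Fmu n \<mu> \<theta> = (\<integral>x. max (vinner n x \<theta>) 0 \<partial>\<mu>)"

text \<open>
  The uniform probability measure on the unit sphere, as a measure on the ambient space: the law
  of \<open>x / |x|\<close> for \<open>x\<close> uniformly distributed in the unit ball.  It is meaningful for \<open>n \<ge> 1\<close>.  The
  lemmas \<open>prob_space_sphere_measure\<close>, \<open>AE_sphere_measure\<close> and \<open>sphere_measure_rotation_invariant\<close>
  below show that it is a probability measure, that it is carried by the sphere, and that it is
  invariant under orthogonal maps.
\<close>

definition Leb :: "nat \<Rightarrow> (nat \<Rightarrow> real) measure" where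
  "Leb n = PiM {..<n} (\<lambda>_. lborel)"

definition unit_ball :: "nat \<Rightarrow> (nat \<Rightarrow> real) set" where
  "unit_ball n = {x \<in> space (Rn n). vnorm n x \<le> 1}"

definition normalize_vec :: "nat \<Rightarrow> (nat \<Rightarrow> real) \<Rightarrow> nat \<Rightarrow> real" where
  "normalize_vec n x = (\<lambda>i\<in>{..<n}. x i / vnorm n x)"

definition sphere_measure :: "nat \<Rightarrow> (nat \<Rightarrow> real) measure" where
  "sphere_measure n = distr (uniform_measure (Leb n) (unit_ball n)) (Rn n) (normalize_vec n)"


lemma space_Rn: "space (Rn n) = {..<n} \<rightarrow>\<^sub>E UNIV"
  by (simp add: Rn_def space_PiM)

lemma sets_Leb [simp, measurable_cong]: "sets (Leb n) = sets (Rn n)"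
  unfolding Leb_def Rn_def by (intro sets_PiM_cong) auto

lemma space_Leb [simp]: "space (Leb n) = space (Rn n)"
  by (rule sets_eq_imp_space_eq) simp

lemma measurable_coord:
  "f \<in> measurable M (Rn n) \<Longrightarrow> i < n \<Longrightarrow> (\<lambda>x. f x i) \<in> borel_measurable M"
  unfolding Rn_def by (rule measurable_compose[OF _ measurable_component_singleton]) auto

lemma measurable_coord':
  "i < n \<Longrightarrow> (\<lambda>x. x i) \<in> borel_measurable (Rn n)"
  by (rule measurable_coord[OF measurable_ident_sets]) auto

lemma measurable_into_Rn:
  assumes "\<And>i. i < n \<Longrightarrow> (\<lambda>x. f x i) \<in> borel_measurable M"
  shows "(\<lambda>x. \<lambda>i\<in>{..<n}. f x i) \<in> measurable M (Rn n)"
  unfolding Rn_def using assms by (intro measurable_restrict) auto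

lemma measurable_vnorm [measurable (raw)]:
  assumes [measurable]: "f \<in> measurable M (Rn n)"
  shows "(\<lambda>x. vnorm n (f x)) \<in> borel_measurable M"
  unfolding L2_set_def
  by (intro measurable_compose[OF _ borel_measurable_sqrt] borel_measurable_sum borel_measurable_power
      measurable_coord[OF assms]) auto

lemma sets_unit_ball [measurable]: "unit_ball n \<in> sets (Rn n)"
  unfolding unit_ball_def by measurable

lemma measurable_normalize_vec [measurable]: "normalize_vec n \<in> measurable (Rn n) (Rn n)"
proof -
  have "(\<lambda>x. \<lambda>i\<in>{..<n}. x i / vnorm n x) \<in> measurable (Rn n) (Rn n)"
    by (intro measurable_into_Rn borel_measurable_divide measurable_coord'
        measurable_vnorm[OF measurable_ident_sets]) auto
  then show ?thesis by (simp add: normalize_vec_def[abs_def])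
qed

lemma sigma_finite_Leb: "sigma_finite_measure (Leb n)"
proof -
  interpret product_sigma_finite "\<lambda>_::nat. lborel :: real measure" by standard
  show ?thesis unfolding Leb_def by (rule sigma_finite) simp
qed

lemma emeasure_Leb_PiE:
  assumes "\<And>i. i < n \<Longrightarrow> A i \<in> sets borel"
  shows "emeasure (Leb n) (Pi\<^sub>E {..<n} A) = (\<Prod>i<n. emeasure lborel (A i))"
proof -
  interpret product_sigma_finite "\<lambda>_::nat. lborel :: real measure" by standard
  show ?thesis unfolding Leb_def using assms by (intro emeasure_PiM) auto
qed

lemma sets_Rn_PiE: "(\<And>i. i < n \<Longrightarrow> A i \<in> sets borel) \<Longrightarrow> Pi\<^sub>E {..<n} A \<in> sets (Rn n)"
  unfolding Rn_def by (intro sets_PiM_I_finite) auto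

lemma emeasure_unit_ball:
  "emeasure (Leb n) (unit_ball n) \<noteq> 0" "emeasure (Leb n) (unit_ball n) \<noteq> \<infinity>"
proof -
  let ?c = "1 / (real n + 1)"
  have "({..<n} \<rightarrow>\<^sub>E {0..?c}) \<subseteq> unit_ball n"
  proof
    fix x assume x: "x \<in> {..<n} \<rightarrow>\<^sub>E {0..?c}"
    have "vnorm n x \<le> (\<Sum>i<n. x i)" using x by (intro L2_set_le_sum) (auto simp: PiE_iff)
    also have "\<dots> \<le> (\<Sum>i<n. ?c)" using x by (intro sum_mono) (auto simp: PiE_iff)
    also have "\<dots> \<le> 1" by simp
    finally show "x \<in> unit_ball n" using x by (auto simp: unit_ball_def space_Rn PiE_iff)
  qed
  then have "emeasure (Leb n) ({..<n} \<rightarrow>\<^sub>E {0..?c}) \<le> emeasure (Leb n) (unit_ball n)"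
    by (intro emeasure_mono) auto
  moreover have "emeasure (Leb n) ({..<n} \<rightarrow>\<^sub>E {0..?c}) > 0"
    by (subst emeasure_Leb_PiE) (auto simp: ennreal_power zero_less_iff_neq_zero[symmetric])
  ultimately show "emeasure (Leb n) (unit_ball n) \<noteq> 0" by auto
  have "unit_ball n \<subseteq> ({..<n} \<rightarrow>\<^sub>E {-1..1})"
  proof
    fix x assume x: "x \<in> unit_ball n"
    have "\<bar>x i\<bar> \<le> 1" if "i < n" for i
    proof -
      have "\<bar>x i\<bar> = sqrt ((x i)\<^sup>2)" by simp
      also have "\<dots> \<le> vnorm n x" unfolding L2_set_def
        using that by (intro real_sqrt_le_mono member_le_sum) auto
      finally show ?thesis using x by (auto simp: unit_ball_def)
    qed
    then have "x i \<in> {-1..1}" if "i < n" for i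
      using that by (simp add: abs_le_iff minus_le_iff)
    moreover have "x \<in> extensional {..<n}"
      using x by (simp add: unit_ball_def space_Rn PiE_iff)
    ultimately show "x \<in> {..<n} \<rightarrow>\<^sub>E {-1..1}"
      by (simp only: PiE_iff lessThan_iff) blast
  qed
  then have "emeasure (Leb n) (unit_ball n) \<le> emeasure (Leb n) ({..<n} \<rightarrow>\<^sub>E {-1..1})"
    by (intro emeasure_mono) (simp_all add: sets_Rn_PiE)
  also have "\<dots> = 2 ^ n"
    by (subst emeasure_Leb_PiE) simp_all
  also have "\<dots> < \<infinity>"
    by (simp add: power_less_top_ennreal)
  finally show "emeasure (Leb n) (unit_ball n) \<noteq> \<infinity>" by simp
qed

lemma prob_space_sphere_measure: "prob_space (sphere_measure n)"
proof -
  interpret prob_space "uniform_measure (Leb n) (unit_ball n)"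
    by (rule prob_space_uniform_measure) (use emeasure_unit_ball in auto)
  show ?thesis unfolding sphere_measure_def by (rule prob_space_distr) measurable
qed

lemma sets_sphere_measure [simp, measurable_cong]: "sets (sphere_measure n) = sets (Rn n)"
  by (simp add: sphere_measure_def)

lemma AE_sphere_measure:
  assumes "n \<ge> 1"
  shows "AE x in sphere_measure n. vnorm n x = 1"
proof -
  have "emeasure (Leb n) ({..<n} \<rightarrow>\<^sub>E {0}) = 0"
    using assms by (subst emeasure_Leb_PiE) (auto simp: power_0_left)
  then have "({..<n} \<rightarrow>\<^sub>E {0}) \<in> null_sets (Leb n)"
    by (intro null_setsI) (simp_all only: sets_Leb sets_Rn_PiE borel_singleton sets.empty_sets)
  then have "AE x in Leb n. x \<notin> ({..<n} \<rightarrow>\<^sub>E {0})" by (rule AE_not_in)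
  then have "AE x in Leb n. vnorm n (normalize_vec n x) = 1"
  proof (rule AE_mp, intro AE_I2 impI)
    fix x assume x: "x \<in> space (Leb n)" "x \<notin> ({..<n} \<rightarrow>\<^sub>E {0})"
    have nz: "vnorm n x \<noteq> 0"
    proof
      assume "vnorm n x = 0"
      then have "\<forall>i\<in>{..<n}. x i = 0" by (simp add: L2_set_eq_0_iff)
      then have "x \<in> {..<n} \<rightarrow>\<^sub>E {0}"
        using x(1) unfolding space_Leb space_Rn PiE_iff by simp
      with x(2) show False by contradiction
    qed
    have "vnorm n (normalize_vec n x) = L2_set (\<lambda>i. x i * (1 / vnorm n x)) {..<n}"
      by (rule L2_set_cong) (auto simp: normalize_vec_def)
    also have "\<dots> = vnorm n x * (1 / vnorm n x)"
      by (rule L2_set_left_distrib[symmetric]) simp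
    finally show "vnorm n (normalize_vec n x) = 1" using nz by simp
  qed
  then have "AE x in uniform_measure (Leb n) (unit_ball n). vnorm n (normalize_vec n x) = 1"
    by (intro AE_uniform_measureI) auto
  then show ?thesis unfolding sphere_measure_def
    by (subst AE_distr_iff) measurable
qed

definition vplus :: "nat \<Rightarrow> (nat \<Rightarrow> real) \<Rightarrow> (nat \<Rightarrow> real) \<Rightarrow> nat \<Rightarrow> real" where
  "vplus n x y = (\<lambda>i\<in>{..<n}. x i + y i)"

definition vminus :: "nat \<Rightarrow> (nat \<Rightarrow> real) \<Rightarrow> (nat \<Rightarrow> real) \<Rightarrow> nat \<Rightarrow> real" where
  "vminus n x y = (\<lambda>i\<in>{..<n}. x i - y i)"

definition vapp :: "nat \<Rightarrow> (nat \<Rightarrow> nat \<Rightarrow> real) \<Rightarrow> (nat \<Rightarrow> real) \<Rightarrow> nat \<Rightarrow> real" where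
  "vapp n U x = (\<lambda>i\<in>{..<n}. \<Sum>j<n. U i j * x j)"

lemma measurable_vplus [measurable (raw)]:
  assumes [measurable]: "f \<in> measurable M (Rn n)" "g \<in> measurable M (Rn n)"
  shows "(\<lambda>x. vplus n (f x) (g x)) \<in> measurable M (Rn n)"
  unfolding vplus_def
  by (intro measurable_into_Rn borel_measurable_add measurable_coord[OF assms(1)] measurable_coord[OF assms(2)])

lemma measurable_vminus [measurable (raw)]:
  assumes [measurable]: "f \<in> measurable M (Rn n)" "g \<in> measurable M (Rn n)"
  shows "(\<lambda>x. vminus n (f x) (g x)) \<in> measurable M (Rn n)"
  unfolding vminus_def
  by (intro measurable_into_Rn borel_measurable_diff measurable_coord[OF assms(1)] measurable_coord[OF assms(2)])

lemma measurable_vapp [measurable]: "vapp n U \<in> measurable (Rn n) (Rn n)"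
proof -
  have "(\<lambda>x. vapp n U x) \<in> measurable (Rn n) (Rn n)"
    unfolding vapp_def
    by (intro measurable_into_Rn borel_measurable_sum borel_measurable_times measurable_const
        measurable_coord') auto
  then show ?thesis by simp
qed

lemma Leb_translate:
  assumes "v \<in> space (Rn n)"
  shows "distr (Leb n) (Rn n) (\<lambda>x. vplus n x v) = Leb n"
proof -
  interpret product_sigma_finite "\<lambda>_::nat. lborel :: real measure" by standard
  have [measurable]: "(\<lambda>x. vplus n x v) \<in> measurable (Leb n) (Rn n)"
    using assms by measurable
  show ?thesis
    unfolding Leb_def
  proof (rule PiM_eqI)
    fix A :: "nat \<Rightarrow> real set"
    assume A: "\<And>i. i \<in> {..<n} \<Longrightarrow> A i \<in> sets lborel"
    have "emeasure (distr (Leb n) (Rn n) (\<lambda>x. vplus n x v)) (Pi\<^sub>E {..<n} A) =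
        emeasure (Leb n) ((\<lambda>x. vplus n x v) -` Pi\<^sub>E {..<n} A \<inter> space (Leb n))"
      using A by (subst emeasure_distr) (simp_all add: sets_Rn_PiE)
    also have "(\<lambda>x. vplus n x v) -` Pi\<^sub>E {..<n} A \<inter> space (Leb n) =
        Pi\<^sub>E {..<n} (\<lambda>i. (\<lambda>t. v i + t) -` A i)"
      by (auto simp: vplus_def space_Rn PiE_iff add.commute)
    also have "emeasure (Leb n) \<dots> = (\<Prod>i<n. emeasure lborel ((\<lambda>t. v i + t) -` A i))"
      using A by (intro emeasure_Leb_PiE) (auto intro!: measurable_sets_borel[where M = borel])
    also have "\<dots> = (\<Prod>i<n. emeasure lborel (A i))"
    proof (rule prod.cong)
      fix i assume "i \<in> {..<n}"
      then have "emeasure lborel (A i) = emeasure (distr lborel borel ((+) (v i))) (A i)"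
        by (simp add: lborel_distr_plus)
      also have "\<dots> = emeasure lborel ((\<lambda>t. v i + t) -` A i)"
        using A[OF \<open>i \<in> _\<close>] by (subst emeasure_distr) auto
      finally show "emeasure lborel ((\<lambda>t. v i + t) -` A i) = emeasure lborel (A i)" by simp
    qed simp
    finally show "emeasure (distr (Pi\<^sub>M {..<n} (\<lambda>_. lborel)) (Rn n) (\<lambda>x. vplus n x v)) (Pi\<^sub>E {..<n} A) =
        (\<Prod>i\<in>{..<n}. emeasure lborel (A i))"
      by (simp add: Leb_def)
  qed (simp_all add: Leb_def[symmetric])
qed

text \<open>Uniqueness of Haar measure in the form needed here: a sigma-finite translation invariant
  measure that agrees with \<open>Leb n\<close> on the unit ball is \<open>Leb n\<close>.\<close>

lemma Leb_unique:
  assumes sets_N: "sets N = sets (Rn n)" and "sigma_finite_measure N"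
    and trans: "\<And>v. v \<in> space (Rn n) \<Longrightarrow> distr N (Rn n) (\<lambda>x. vplus n x v) = N"
    and ball: "emeasure N (unit_ball n) = emeasure (Leb n) (unit_ball n)"
  shows "N = Leb n"
proof (rule measure_eqI)
  show "sets N = sets (Leb n)" by (simp add: sets_N)
next
  fix A assume "A \<in> sets N"
  then have A [measurable]: "A \<in> sets (Rn n)" by (simp add: sets_N)
  interpret L: sigma_finite_measure "Leb n" by (rule sigma_finite_Leb)
  interpret N: sigma_finite_measure N by fact
  interpret P: pair_sigma_finite N "Leb n" ..
  note sets_N [measurable_cong]
  have sp: "space N = space (Rn n)" using sets_N by (rule sets_eq_imp_space_eq)
  define f g :: "(nat \<Rightarrow> real) \<Rightarrow> ennreal" where "f = indicator A" and "g = indicator (unit_ball n)"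
  have f [measurable]: "f \<in> borel_measurable (Rn n)" and g [measurable]: "g \<in> borel_measurable (Rn n)"
    by (simp_all add: f_def g_def)
  have m1: "(\<lambda>(x, y). f (vplus n x y) * g y) \<in> borel_measurable (N \<Otimes>\<^sub>M Leb n)"
    by measurable
  have m2: "(\<lambda>(x, y). f y * g (vminus n y x)) \<in> borel_measurable (N \<Otimes>\<^sub>M Leb n)"
    by measurable
  have comm: "vplus n x y = vplus n y x" for x y by (simp add: vplus_def add.commute)
  have pm: "vminus n (vplus n y x) x = y" if "y \<in> space (Rn n)" for x y
    using that by (auto simp: vminus_def vplus_def space_Rn PiE_iff extensional_def fun_eq_iff)
  have neg: "g (vminus n y x) = g (vminus n x y)" for x y
    by (auto simp: g_def unit_ball_def space_Rn vminus_def L2_set_def power2_commute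
        split: split_indicator)
  have trN: "(\<integral>\<^sup>+x. h (vplus n x v) \<partial>N) = (\<integral>\<^sup>+x. h x \<partial>N)"
    if "v \<in> space (Rn n)" and [measurable]: "h \<in> borel_measurable (Rn n)" for v h
  proof -
    have "(\<integral>\<^sup>+x. h x \<partial>N) = (\<integral>\<^sup>+x. h x \<partial>distr N (Rn n) (\<lambda>x. vplus n x v))"
      by (simp add: trans[OF that(1)])
    also have "\<dots> = (\<integral>\<^sup>+x. h (vplus n x v) \<partial>N)"
      using that(1) by (intro nn_integral_distr) measurable
    finally show ?thesis by simp
  qed
  have trL: "(\<integral>\<^sup>+x. h (vplus n x v) \<partial>Leb n) = (\<integral>\<^sup>+x. h x \<partial>Leb n)"
    if "v \<in> space (Rn n)" and [measurable]: "h \<in> borel_measurable (Rn n)" for v h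
  proof -
    have "(\<integral>\<^sup>+x. h x \<partial>Leb n) = (\<integral>\<^sup>+x. h x \<partial>distr (Leb n) (Rn n) (\<lambda>x. vplus n x v))"
      by (simp add: Leb_translate[OF that(1)])
    also have "\<dots> = (\<integral>\<^sup>+x. h (vplus n x v) \<partial>Leb n)"
      using that(1) by (intro nn_integral_distr) measurable
    finally show ?thesis by simp
  qed
  have "emeasure N A * emeasure (Leb n) (unit_ball n) = (\<integral>\<^sup>+x. f x \<partial>N) * (\<integral>\<^sup>+y. g y \<partial>Leb n)"
    by (simp add: f_def g_def)
  also have "\<dots> = (\<integral>\<^sup>+y. (\<integral>\<^sup>+x. f x \<partial>N) * g y \<partial>Leb n)"
    by (simp add: nn_integral_cmult)
  also have "\<dots> = (\<integral>\<^sup>+y. (\<integral>\<^sup>+x. f (vplus n x y) * g y \<partial>N) \<partial>Leb n)"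
  proof (rule nn_integral_cong)
    fix y assume y: "y \<in> space (Leb n)"
    have "(\<integral>\<^sup>+x. f (vplus n x y) * g y \<partial>N) = (\<integral>\<^sup>+x. f (vplus n x y) \<partial>N) * g y"
      using y by (intro nn_integral_multc) measurable
    then show "(\<integral>\<^sup>+x. f x \<partial>N) * g y = (\<integral>\<^sup>+x. f (vplus n x y) * g y \<partial>N)"
      using y by (simp add: trN)
  qed
  also have "\<dots> = (\<integral>\<^sup>+x. (\<integral>\<^sup>+y. f (vplus n x y) * g y \<partial>Leb n) \<partial>N)"
    by (rule P.Fubini'[OF m1])
  also have "\<dots> = (\<integral>\<^sup>+x. (\<integral>\<^sup>+y. f y * g (vminus n y x) \<partial>Leb n) \<partial>N)"
  proof (rule nn_integral_cong)
    fix x assume x: "x \<in> space N"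
    have "(\<integral>\<^sup>+y. f (vplus n x y) * g y \<partial>Leb n) =
        (\<integral>\<^sup>+y. f (vplus n y x) * g (vminus n (vplus n y x) x) \<partial>Leb n)"
      by (intro nn_integral_cong) (simp add: pm comm[of x])
    also have "\<dots> = (\<integral>\<^sup>+y. f y * g (vminus n y x) \<partial>Leb n)"
      using x by (intro trL[where h = "\<lambda>z. f z * g (vminus n z x)"]) (auto simp: sp)
    finally show "(\<integral>\<^sup>+y. f (vplus n x y) * g y \<partial>Leb n) = (\<integral>\<^sup>+y. f y * g (vminus n y x) \<partial>Leb n)" .
  qed
  also have "\<dots> = (\<integral>\<^sup>+y. (\<integral>\<^sup>+x. f y * g (vminus n y x) \<partial>N) \<partial>Leb n)"
    by (rule P.Fubini'[OF m2, symmetric])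
  also have "\<dots> = (\<integral>\<^sup>+y. f y * (\<integral>\<^sup>+x. g x \<partial>N) \<partial>Leb n)"
  proof (rule nn_integral_cong)
    fix y assume y: "y \<in> space (Leb n)"
    have "(\<integral>\<^sup>+x. f y * g (vminus n y x) \<partial>N) = f y * (\<integral>\<^sup>+x. g (vminus n y x) \<partial>N)"
      using y by (intro nn_integral_cmult) measurable
    also have "(\<integral>\<^sup>+x. g (vminus n y x) \<partial>N) = (\<integral>\<^sup>+x. g (vminus n x y) \<partial>N)"
      by (simp add: neg)
    also have "\<dots> = (\<integral>\<^sup>+x. g (vminus n (vplus n x y) y) \<partial>N)"
      using y by (intro trN[where h = "\<lambda>z. g (vminus n z y)", symmetric]) auto
    also have "\<dots> = (\<integral>\<^sup>+x. g x \<partial>N)"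
      by (intro nn_integral_cong) (simp add: pm sp)
    finally show "(\<integral>\<^sup>+x. f y * g (vminus n y x) \<partial>N) = f y * (\<integral>\<^sup>+x. g x \<partial>N)" .
  qed
  also have "\<dots> = emeasure (Leb n) A * emeasure N (unit_ball n)"
    by (simp add: nn_integral_multc f_def g_def sets_N)
  finally have "emeasure (Leb n) (unit_ball n) * emeasure N A =
      emeasure (Leb n) (unit_ball n) * emeasure (Leb n) A"
    by (simp add: ball mult.commute)
  then show "emeasure N A = emeasure (Leb n) A"
    using emeasure_unit_ball[of n] by (simp add: ennreal_mult_cancel_left)
qed

definition orthogonal_mat :: "nat \<Rightarrow> (nat \<Rightarrow> nat \<Rightarrow> real) \<Rightarrow> bool" where
  "orthogonal_mat n U \<longleftrightarrow>
    (\<forall>i<n. \<forall>j<n. (\<Sum>k<n. U i k * U j k) = (if i = j then 1 else 0)) \<and>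
    (\<forall>i<n. \<forall>j<n. (\<Sum>k<n. U k i * U k j) = (if i = j then 1 else 0))"

lemma vapp_in_space [simp]: "vapp n U x \<in> space (Rn n)"
  by (auto simp: vapp_def space_Rn)

lemma vapp_inverse:
  assumes "\<forall>i<n. \<forall>j<n. (\<Sum>k<n. U i k * V k j) = (if i = j then 1 else 0)" "x \<in> space (Rn n)"
  shows "vapp n U (vapp n V x) = x"
proof
  fix i
  show "vapp n U (vapp n V x) i = x i"
  proof (cases "i < n")
    case True
    have "vapp n U (vapp n V x) i = (\<Sum>k<n. U i k * (\<Sum>j<n. V k j * x j))"
      using True by (simp add: vapp_def)
    also have "\<dots> = (\<Sum>k<n. \<Sum>j<n. U i k * V k j * x j)"
      by (simp add: sum_distrib_left mult.assoc)
    also have "\<dots> = (\<Sum>j<n. \<Sum>k<n. U i k * V k j * x j)"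
      by (rule sum.swap)
    also have "\<dots> = (\<Sum>j<n. (if i = j then x j else 0))"
      using assms(1) True by (intro sum.cong) (auto simp: sum_distrib_right[symmetric])
    also have "\<dots> = x i" using True by simp
    finally show ?thesis .
  next
    case False
    then show ?thesis using assms(2) by (auto simp: vapp_def space_Rn PiE_iff extensional_def)
  qed
qed

lemma vnorm_vapp:
  assumes "orthogonal_mat n U"
  shows "vnorm n (vapp n U x) = vnorm n x"
proof -
  have "(\<Sum>k<n. (vapp n U x k)\<^sup>2) = (\<Sum>k<n. \<Sum>i<n. \<Sum>j<n. U k i * U k j * (x i * x j))"
    by (simp add: vapp_def power2_eq_square sum_product mult_ac)
  also have "\<dots> = (\<Sum>i<n. \<Sum>k<n. \<Sum>j<n. U k i * U k j * (x i * x j))"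
    by (rule sum.swap)
  also have "\<dots> = (\<Sum>i<n. \<Sum>j<n. \<Sum>k<n. U k i * U k j * (x i * x j))"
    by (intro sum.cong refl sum.swap)
  also have "\<dots> = (\<Sum>i<n. \<Sum>j<n. if i = j then x i * x j else 0)"
    using assms by (intro sum.cong) (auto simp: orthogonal_mat_def sum_distrib_right[symmetric])
  also have "\<dots> = (\<Sum>i<n. (x i)\<^sup>2)" by (simp add: power2_eq_square)
  finally show ?thesis by (simp add: L2_set_def)
qed

lemma vapp_unit_ball:
  assumes "orthogonal_mat n U" "x \<in> space (Rn n)"
  shows "vapp n U x \<in> unit_ball n \<longleftrightarrow> x \<in> unit_ball n"
  using assms by (simp add: unit_ball_def vnorm_vapp)

lemma Leb_orthogonal:
  assumes U: "orthogonal_mat n U"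
  shows "distr (Leb n) (Rn n) (vapp n U) = Leb n"
proof (rule Leb_unique)
  let ?N = "distr (Leb n) (Rn n) (vapp n U)"
  define V where "V = (\<lambda>i j. U j i)"
  have UV: "vapp n U (vapp n V x) = x" if "x \<in> space (Rn n)" for x
    using U that by (intro vapp_inverse) (auto simp: orthogonal_mat_def V_def)
  have VU: "vapp n V (vapp n U x) = x" if "x \<in> space (Rn n)" for x
    using U that by (intro vapp_inverse) (auto simp: orthogonal_mat_def V_def)
  show "sets ?N = sets (Rn n)" by simp
  have "distr ?N (Rn n) (vapp n V) = distr (Leb n) (Rn n) (vapp n V \<circ> vapp n U)"
    by (rule distr_distr) auto
  also have "\<dots> = distr (Leb n) (Leb n) (\<lambda>x. x)"
    by (rule distr_cong) (auto simp: VU)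
  also have "\<dots> = Leb n" by (rule distr_id2) simp
  finally have "sigma_finite_measure (distr ?N (Rn n) (vapp n V))"
    using sigma_finite_Leb by simp
  then show "sigma_finite_measure ?N"
    by (rule sigma_finite_measure_distr) auto
  show "emeasure ?N (unit_ball n) = emeasure (Leb n) (unit_ball n)"
  proof -
    have "vapp n U -` unit_ball n \<inter> space (Leb n) = unit_ball n"
      using U by (auto simp: vnorm_vapp unit_ball_def)
    then show ?thesis by (subst emeasure_distr) auto
  qed
  fix v assume v: "v \<in> space (Rn n)"
  define w where "w = vapp n V v"
  have w: "w \<in> space (Rn n)" by (simp add: w_def)
  have lin: "vplus n (vapp n U x) v = vapp n U (vplus n x w)" for x
  proof -
    have "vplus n (vapp n U x) (vapp n U w) = vapp n U (vplus n x w)"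
      by (auto simp: vplus_def vapp_def fun_eq_iff sum.distrib[symmetric] distrib_left)
    then show ?thesis using UV[OF v] by (simp add: w_def)
  qed
  have [measurable]: "(\<lambda>x. vplus n x v) \<in> measurable (Rn n) (Rn n)"
    "(\<lambda>x. vplus n x w) \<in> measurable (Rn n) (Rn n)"
    using v w by measurable
  have "distr ?N (Rn n) (\<lambda>x. vplus n x v) = distr (Leb n) (Rn n) ((\<lambda>x. vplus n x v) \<circ> vapp n U)"
    by (rule distr_distr) measurable
  also have "\<dots> = distr (Leb n) (Rn n) (vapp n U \<circ> (\<lambda>x. vplus n x w))"
    by (simp add: comp_def lin)
  also have "\<dots> = distr (distr (Leb n) (Rn n) (\<lambda>x. vplus n x w)) (Rn n) (vapp n U)"
    by (rule distr_distr[symmetric]) measurable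
  also have "\<dots> = ?N" by (simp add: Leb_translate[OF w])
  finally show "distr ?N (Rn n) (\<lambda>x. vplus n x v) = ?N" .
qed

lemma uniform_ball_orthogonal:
  assumes U: "orthogonal_mat n U"
  shows "distr (uniform_measure (Leb n) (unit_ball n)) (Rn n) (vapp n U) =
    uniform_measure (Leb n) (unit_ball n)"
proof (rule measure_eqI)
  fix A assume "A \<in> sets (distr (uniform_measure (Leb n) (unit_ball n)) (Rn n) (vapp n U))"
  then have A [measurable]: "A \<in> sets (Rn n)" by simp
  have pre [measurable]: "vapp n U -` A \<inter> space (Rn n) \<in> sets (Rn n)"
    by (rule measurable_sets[OF measurable_vapp A])
  have "emeasure (Leb n) (unit_ball n \<inter> A) =
      emeasure (distr (Leb n) (Rn n) (vapp n U)) (unit_ball n \<inter> A)"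
    by (simp add: Leb_orthogonal[OF U])
  also have "\<dots> = emeasure (Leb n) (vapp n U -` (unit_ball n \<inter> A) \<inter> space (Leb n))"
    by (rule emeasure_distr) auto
  also have "vapp n U -` (unit_ball n \<inter> A) \<inter> space (Leb n) =
      unit_ball n \<inter> (vapp n U -` A \<inter> space (Rn n))"
    using U by (auto simp: vapp_unit_ball unit_ball_def vnorm_vapp)
  finally show "emeasure (distr (uniform_measure (Leb n) (unit_ball n)) (Rn n) (vapp n U)) A =
      emeasure (uniform_measure (Leb n) (unit_ball n)) A"
    by (subst emeasure_distr) auto
qed simp

theorem sphere_measure_rotation_invariant:
  assumes U: "orthogonal_mat n U"
  shows "distr (sphere_measure n) (Rn n) (vapp n U) = sphere_measure n"
proof -
  let ?B = "uniform_measure (Leb n) (unit_ball n)"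
  have comm: "vapp n U (normalize_vec n x) = normalize_vec n (vapp n U x)" for x
    using vnorm_vapp[OF U, of x]
    by (simp add: normalize_vec_def vapp_def fun_eq_iff sum_divide_distrib)
  have "distr (sphere_measure n) (Rn n) (vapp n U) = distr ?B (Rn n) (vapp n U \<circ> normalize_vec n)"
    unfolding sphere_measure_def by (rule distr_distr) measurable
  also have "\<dots> = distr ?B (Rn n) (normalize_vec n \<circ> vapp n U)"
    by (simp add: comp_def comm)
  also have "\<dots> = distr (distr ?B (Rn n) (vapp n U)) (Rn n) (normalize_vec n)"
    by (rule distr_distr[symmetric]) measurable
  also have "\<dots> = sphere_measure n"
    by (simp add: uniform_ball_orthogonal[OF U] sphere_measure_def)
  finally show ?thesis .
qed

end

theory Submission
  imports Defs
begin

text \<open>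
  Since \<open>\<mu>\<close> is centered, \<open>F\<^sub>\<mu>(\<theta>)\<close> is half of \<open>A(\<theta>) = \<integral> \<bar>x \<cdot> \<theta>\<bar> d\<mu>(x)\<close>.  By Fubini, the second
  moment of \<open>A\<close> on the sphere is the integral over \<open>\<mu> \<otimes> \<mu>\<close> of the kernel
  \<open>H(x, y) = E \<bar>x \<cdot> \<theta>\<bar> \<bar>y \<cdot> \<theta>\<bar>\<close>, where \<open>E\<close> is the mean over \<open>\<theta>\<close>.  This kernel is explicit: if \<open>t\<close> is the
  cosine of the angle between \<open>x\<close> and \<open>y\<close>, then
  \<open>H(x, y) = (2 / (\<pi> n)) \<bar>x\<bar> \<bar>y\<bar> (t arcsin t + sqrt (1 - t\<^sup>2))\<close>
  (\<open>sphere_integral_abs_product\<close>).  To see this, average first over rotations of \<open>\<theta>\<close> in the plane of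
  \<open>x\<close> and \<open>y\<close>, which is an integral over an angle; the remaining mean only involves
  \<open>E (u \<cdot> \<theta>)\<^sup>2 = 1 / n\<close> for unit vectors \<open>u\<close>.

  The function of \<open>t\<close> lies between \<open>1 + t\<^sup>2 / 2\<close> and \<open>1 + t\<^sup>2 / 2 + t^4\<close> (\<open>arc_kernel_bounds\<close>).  By the
  upper bound, the second moment of \<open>A\<close> is at most \<open>2 / (\<pi> n)\<close> times the sum of three double
  integrals.  That of \<open>\<bar>x\<bar> \<bar>y\<bar>\<close> is the square of the trace of \<open>Cov1\<close>, namely \<open>\<alpha>\<^sup>2 n\<close>; that of
  \<open>(x \<cdot> y)\<^sup>2 / (\<bar>x\<bar> \<bar>y\<bar>)\<close> is the squared Hilbert-Schmidt norm of \<open>Cov1\<close>, namely \<open>\<alpha>\<^sup>2\<close>, and it is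
  counted with the factor \<open>1/2\<close>; the third is the quartic integral, at most \<open>\<beta> \<alpha>\<^sup>2 / n\<close>.

  The mean of \<open>A\<close> is \<open>m \<alpha> sqrt n\<close> with \<open>m = E \<bar>u \<cdot> \<theta>\<bar>\<close> for any unit vector \<open>u\<close>.  Here \<open>m\<^sup>2\<close> is the
  mean of \<open>H(u, \<eta>)\<close> over a uniform \<open>\<eta>\<close>, so the lower bound for the kernel gives
  \<open>m\<^sup>2 \<ge> (2 / (\<pi> n)) (1 + 1 / (2 n))\<close> (\<open>sphere_mean_abs_lower\<close>).  Thus the square of the mean of \<open>A\<close>
  is at least \<open>(2 / (\<pi> n)) (\<alpha>\<^sup>2 n + \<alpha>\<^sup>2 / 2)\<close>.  The first two terms cancel exactly, and the variance of
  \<open>A\<close> is bounded by the quartic term, which has the order \<open>\<beta> \<alpha>\<^sup>2 / n\<^sup>2\<close>.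
\<close>

section \<open>The arcsine kernel\<close>

text \<open>If \<open>G, H\<close> are standard Gaussian variables with correlation \<open>t\<close>, then the mean of \<open>\<bar>G H\<bar>\<close> is
  \<open>(2 / pi) * arc_kernel t\<close>.  On the sphere the same function appears, since only the angle
  between the two directions matters; see \<open>sphere_integral_abs_product\<close>.\<close>

definition arc_kernel :: "real \<Rightarrow> real" where
  "arc_kernel t = t * arcsin t + sqrt (1 - t\<^sup>2)"

lemma arc_kernel_minus: "\<bar>t\<bar> \<le> 1 \<Longrightarrow> arc_kernel (- t) = arc_kernel t"
  by (simp add: arc_kernel_def arcsin_minus)

lemma arc_kernel_1: "arc_kernel 1 = pi / 2"
  by (simp add: arc_kernel_def)

lemma sin_ge_cubic:
  assumes "0 \<le> (x::real)"
  shows "x - x ^ 3 / 6 \<le> sin x"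
proof -
  have "\<bar>sin x - x\<bar> \<le> x ^ 3 / 6"
    using Maclaurin_sin_bound[of x 3] assms
    by (simp add: numeral_3_eq_3 sin_coeff_def fact_numeral field_simps)
  then show ?thesis by linarith
qed

text \<open>This is the bound \<open>arcsin t \<le> t + 4 t^3\<close>, written in terms of the angle.  The cubic lower bound
  for the sine gives \<open>sin x \<ge> x / 2\<close> on the interval, so \<open>x^3 / 6\<close> is at most
  \<open>(8 / 6) sin^3 x\<close>.\<close>

lemma le_sin_plus_cube:
  assumes "0 \<le> (x::real)" "x \<le> pi / 2"
  shows "x \<le> sin x + 4 * sin x ^ 3"
proof -
  \<comment> \<open>A value with \<open>(16/5 / 2)\<^sup>2 \<le> 3\<close>, which is what \<open>1 - x\<^sup>2 / 6 \<ge> 1 / 2\<close> needs.\<close>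
  have pi: "pi < 16/5" using pi_approx by simp
  have "x * x \<le> (8/5) * (8/5)" using assms pi by (intro mult_mono) auto
  then have "x * (x * x) \<le> x * 3" using assms by (intro mult_left_mono) auto
  then have "x / 2 \<le> x - x ^ 3 / 6" by (simp add: power3_eq_cube)
  also have "\<dots> \<le> sin x" by (rule sin_ge_cubic) fact
  finally have "(x / 2) ^ 3 \<le> sin x ^ 3" using assms by (intro power_mono) auto
  then have "x ^ 3 / 8 \<le> sin x ^ 3" by (simp add: power_divide)
  moreover have "0 \<le> x ^ 3" using assms by simp
  ultimately have "x ^ 3 / 6 \<le> 4 * sin x ^ 3" by linarith
  with sin_ge_cubic[OF assms(1)] show ?thesis by linarith
qed

lemma arc_kernel_sin:
  assumes "0 \<le> x" "x \<le> pi / 2"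
  shows "arc_kernel (sin x) = x * sin x + cos x"
proof -
  have "sqrt (1 - (sin x)\<^sup>2) = cos x"
    using assms by (simp add: cos_squared_eq[symmetric] cos_ge_zero)
  then show ?thesis using assms by (simp add: arc_kernel_def arcsin_sin)
qed

text \<open>The Taylor polynomial \<open>1 + t\<^sup>2 / 2\<close> is exact up to a one-sided error of order \<open>t^4\<close>.  With
  \<open>\<bar>t\<bar> = sin x\<close> both sides become smooth functions of \<open>x\<close> up to the endpoint \<open>\<bar>t\<bar> = 1\<close>, where
  the arcsine is not differentiable.  They agree at \<open>x = 0\<close>, and the derivatives compare because
  \<open>sin x \<le> x \<le> sin x + 4 * sin x ^ 3\<close>.\<close>

lemma arc_kernel_bounds:
  assumes "\<bar>t\<bar> \<le> 1"
  shows arc_kernel_lower: "1 + t\<^sup>2 / 2 \<le> arc_kernel t"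
    and arc_kernel_upper: "arc_kernel t \<le> 1 + t\<^sup>2 / 2 + t ^ 4"
proof -
  define x where "x = arcsin \<bar>t\<bar>"
  have x: "0 \<le> x" "x \<le> pi / 2" and t: "\<bar>t\<bar> = sin x"
    using assms arcsin_bounded[of "\<bar>t\<bar>"] by (auto simp: x_def sin_arcsin arcsin_nonneg)
  have k: "arc_kernel t = x * sin x + cos x"
    using arc_kernel_sin[OF x] t[symmetric] arc_kernel_minus[OF assms] by (auto simp: abs_if split: if_splits)
  have t2: "t\<^sup>2 = (sin x)\<^sup>2" by (simp flip: t)
  have t4: "t ^ 4 = sin x ^ 4" by (simp flip: t)
  have "0 * sin 0 + cos 0 - (1 + (sin 0)\<^sup>2 / 2) \<le> x * sin x + cos x - (1 + (sin x)\<^sup>2 / 2)"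
  proof (rule DERIV_nonneg_imp_nondecreasing[OF x(1)], intro exI conjI)
    fix y assume y: "0 \<le> y" "y \<le> x"
    show "((\<lambda>y. y * sin y + cos y - (1 + (sin y)\<^sup>2 / 2)) has_real_derivative
        (y - sin y) * cos y) (at y)"
      by (auto intro!: derivative_eq_intros simp: algebra_simps)
    show "0 \<le> (y - sin y) * cos y"
      using y x by (intro mult_nonneg_nonneg cos_ge_zero) (auto simp: sin_x_le_x)
  qed
  then show "1 + t\<^sup>2 / 2 \<le> arc_kernel t" by (simp add: k t2)
  have "1 + (sin 0)\<^sup>2 / 2 + sin 0 ^ 4 - (0 * sin 0 + cos 0)
      \<le> 1 + (sin x)\<^sup>2 / 2 + sin x ^ 4 - (x * sin x + cos x)"
  proof (rule DERIV_nonneg_imp_nondecreasing[OF x(1)], intro exI conjI)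
    fix y assume y: "0 \<le> y" "y \<le> x"
    show "((\<lambda>y. 1 + (sin y)\<^sup>2 / 2 + sin y ^ 4 - (y * sin y + cos y)) has_real_derivative
        (sin y + 4 * sin y ^ 3 - y) * cos y) (at y)"
      by (auto intro!: derivative_eq_intros simp: algebra_simps)
    show "0 \<le> (sin y + 4 * sin y ^ 3 - y) * cos y"
      using y x le_sin_plus_cube[of y] by (intro mult_nonneg_nonneg cos_ge_zero) auto
  qed
  then show "arc_kernel t \<le> 1 + t\<^sup>2 / 2 + t ^ 4" by (simp add: k t2 t4)
qed

text \<open>The integrand changes sign at \<open>a\<close> and at \<open>pi - a\<close>, where \<open>cos (2 * a) = - c\<close>; on each of the
  three pieces an antiderivative is elementary.\<close>

lemma has_integral_abs_shifted_cos:
  assumes "\<bar>c\<bar> \<le> 1"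
  shows "((\<lambda>\<psi>. \<bar>c + cos (2 * \<psi>)\<bar> / 2) has_integral arc_kernel c) {0..pi}"
proof -
  define a where "a = arccos (- c) / 2"
  have a: "0 \<le> a" "a \<le> pi / 2" and ca: "cos (2 * a) = - c"
    using assms arccos_lbound[of "- c"] arccos_ubound[of "- c"] by (auto simp: a_def)
  have sa: "sin (2 * a) = sqrt (1 - c\<^sup>2)"
    using assms by (simp add: a_def sin_arccos_abs)
  have as: "2 * a = pi / 2 + arcsin c"
    using arcsin_arccos_eq[of c] arccos_minus[of c] assms by (simp add: a_def)
  let ?g = "\<lambda>\<psi>. \<bar>c + cos (2 * \<psi>)\<bar> / 2"
  let ?G = "\<lambda>\<psi>. (c * \<psi> + sin (2 * \<psi>) / 2) / 2"
  have G: "(?G has_vector_derivative (c + cos (2 * \<psi>)) / 2) (at \<psi> within S)" for \<psi> S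
    unfolding has_real_derivative_iff_has_vector_derivative[symmetric]
    by (auto intro!: derivative_eq_intros)
  have pos: "0 \<le> c + cos (2 * \<psi>)" if "0 \<le> \<psi>" "\<psi> \<le> a" for \<psi>
    using that a ca cos_monotone_0_pi_le[of "2 * \<psi>" "2 * a"] by auto
  have neg: "c + cos (2 * \<psi>) \<le> 0" if "a \<le> \<psi>" "\<psi> \<le> pi - a" for \<psi>
  proof (cases "\<psi> \<le> pi / 2")
    case True
    then show ?thesis using that a ca cos_monotone_0_pi_le[of "2 * a" "2 * \<psi>"] by auto
  next
    case False
    have "cos (2 * (pi - \<psi>)) = cos (2 * \<psi>)" by (simp add: right_diff_distrib cos_diff)
    then show ?thesis
      using False that a ca cos_monotone_0_pi_le[of "2 * a" "2 * (pi - \<psi>)"] by auto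
  qed
  have pos': "0 \<le> c + cos (2 * \<psi>)" if "pi - a \<le> \<psi>" "\<psi> \<le> pi" for \<psi>
  proof -
    have "cos (2 * (pi - \<psi>)) = cos (2 * \<psi>)" by (simp add: right_diff_distrib cos_diff)
    then show ?thesis using pos[of "pi - \<psi>"] that by simp
  qed
  have i1: "(?g has_integral (?G a - ?G 0)) {0..a}"
    by (rule has_integral_eq[OF _ fundamental_theorem_of_calculus[OF a(1) G]]) (use pos in auto)
  have i2: "(?g has_integral (- ?G (pi - a) - (- ?G a))) {a..pi - a}"
    by (rule has_integral_eq[OF _ fundamental_theorem_of_calculus[OF _ has_vector_derivative_minus[OF G]]])
       (use neg a in \<open>auto simp: abs_of_nonpos field_simps\<close>)
  have i3: "(?g has_integral (?G pi - ?G (pi - a))) {pi - a..pi}"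
    by (rule has_integral_eq[OF _ fundamental_theorem_of_calculus[OF _ G]]) (use pos' a in auto)
  have "(?g has_integral (?G a - ?G 0 + (- ?G (pi - a) - (- ?G a)) + (?G pi - ?G (pi - a)))) {0..pi}"
    using a by (intro has_integral_combine[OF _ _ has_integral_combine[OF _ _ i1 i2] i3]) auto
  moreover have "?G a - ?G 0 + (- ?G (pi - a) - (- ?G a)) + (?G pi - ?G (pi - a)) = arc_kernel c"
  proof -
    have "sin (2 * (pi - a)) = - sin (2 * a)" by (simp add: right_diff_distrib sin_diff)
    then have "?G a - ?G 0 + (- ?G (pi - a) - (- ?G a)) + (?G pi - ?G (pi - a)) =
        c * (2 * a) - c * (pi / 2) + sin (2 * a)"
      by (simp add: field_simps)
    also have "\<dots> = arc_kernel c" unfolding sa unfolding as by (simp add: arc_kernel_def algebra_simps)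
    finally show ?thesis .
  qed
  ultimately show ?thesis by simp
qed

text \<open>The integrand has period \<open>pi\<close>, so the phase \<open>d\<close> does not affect the integral over a period.\<close>

lemma integral_abs_shifted_cos_phase:
  assumes c: "\<bar>c\<bar> \<le> 1" and d: "0 \<le> d" "d \<le> pi"
  shows "integral {0..pi} (\<lambda>\<psi>. \<bar>c + cos (2 * (\<psi> + d))\<bar> / 2) = arc_kernel c"
proof -
  let ?g = "\<lambda>\<psi>. \<bar>c + cos (2 * \<psi>)\<bar> / 2"
  have int: "?g integrable_on {a..b}" for a b
    by (intro integrable_continuous_interval continuous_intros) auto
  have shift: "integral {a..b} (\<lambda>\<psi>. ?g (\<psi> + e)) = integral {a + e..b + e} ?g" for a b e
    using integral_shift[of a e b ?g] by (simp add: add.commute continuous_intros o_def)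
  have per: "?g (\<psi> + pi) = ?g \<psi>" for \<psi>
    by (simp add: distrib_left)
  have "integral {0..pi} (\<lambda>\<psi>. ?g (\<psi> + d)) = integral {d..pi + d} ?g"
    using shift[of 0 pi d] by simp
  also have "\<dots> = integral {d..pi} ?g + integral {pi..pi + d} ?g"
    using d by (intro Henstock_Kurzweil_Integration.integral_combine[symmetric] int) auto
  also have "integral {pi..pi + d} ?g = integral {0..d} ?g"
    using shift[of 0 d pi] by (simp add: per add.commute)
  also have "integral {d..pi} ?g + integral {0..d} ?g = integral {0..pi} ?g"
    using Henstock_Kurzweil_Integration.integral_combine[OF d int] by simp
  also have "\<dots> = arc_kernel c"
    using has_integral_abs_shifted_cos[OF c] by (rule integral_unique)
  finally show ?thesis .
qed

text \<open>The planar computation behind the kernel formula.  In polar coordinates the vector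
  \<open>(X, Y)\<close> has length \<open>r\<close>, and with \<open>(c, s) = (cos w, sin w)\<close> the two factors are projections
  of the vector rotated by \<open>\<psi>\<close> onto two lines at angle \<open>w\<close>.  Their product is a product of two
  cosines, that is \<open>r\<^sup>2 / 2\<close> times a shifted cosine of the double angle.\<close>

lemma integral_rotated_product:
  assumes cs: "c\<^sup>2 + s\<^sup>2 = 1"
  shows "integral {0..pi} (\<lambda>\<psi>. \<bar>X * cos \<psi> - Y * sin \<psi>\<bar> *
      \<bar>c * (X * cos \<psi> - Y * sin \<psi>) + s * (X * sin \<psi> + Y * cos \<psi>)\<bar>)
    = (X\<^sup>2 + Y\<^sup>2) * arc_kernel c"
proof -
  obtain w where w: "c = cos w" "s = sin w"
    using sincos_total_2pi[OF cs] by blast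
  define h where "h = w / 2"
  \<comment> \<open>Measuring angles from the bisector of the two lines makes the product of cosines symmetric.\<close>
  define X' Y' where "X' = X * cos h + Y * sin h" and "Y' = Y * cos h - X * sin h"
  have XY: "X = X' * cos h - Y' * sin h" "Y = X' * sin h + Y' * cos h"
  proof -
    have "X' * cos h - Y' * sin h = X * ((cos h)\<^sup>2 + (sin h)\<^sup>2)"
      by (simp only: X'_def Y'_def) algebra
    then show "X = X' * cos h - Y' * sin h" by simp
    have "X' * sin h + Y' * cos h = Y * ((cos h)\<^sup>2 + (sin h)\<^sup>2)"
      by (simp only: X'_def Y'_def) algebra
    then show "Y = X' * sin h + Y' * cos h" by simp
  qed
  have "\<exists>r d. 0 \<le> d \<and> d \<le> pi \<and> X' = r * cos d \<and> Y' = r * sin d"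
  proof (cases "X' = 0 \<and> Y' = 0")
    case True
    then show ?thesis by (intro exI[of _ 0]) auto
  next
    case False
    \<comment> \<open>A negative \<open>r\<close> is admitted so that the angle can be taken in a half turn, the range
      of integration; the integrand is even in \<open>(X, Y)\<close>.\<close>
    define r where "r = (if Y' \<ge> 0 then 1 else -1) * sqrt (X'\<^sup>2 + Y'\<^sup>2)"
    have r: "r \<noteq> 0" "r\<^sup>2 = X'\<^sup>2 + Y'\<^sup>2"
      using False by (auto simp: r_def sum_power2_eq_zero_iff)
    have "0 \<le> Y' / r" by (simp add: r_def zero_le_divide_iff)
    moreover have "(X' / r)\<^sup>2 + (Y' / r)\<^sup>2 = 1"
      unfolding power_divide add_divide_distrib[symmetric] r(2)[symmetric] using r(1) by simp
    ultimately obtain d where "0 \<le> d" "d \<le> pi" "X' / r = cos d" "Y' / r = sin d"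
      using sincos_total_pi by blast
    with r show ?thesis by (intro exI[of _ r] exI[of _ d]) (auto simp: field_simps)
  qed
  then obtain r d where d: "0 \<le> d" "d \<le> pi" and rd: "X' = r * cos d" "Y' = r * sin d" by blast
  have Xr: "X = r * cos (d + h)" and Yr: "Y = r * sin (d + h)"
    by (simp_all add: XY rd cos_add sin_add algebra_simps)
  have r2: "X\<^sup>2 + Y\<^sup>2 = r\<^sup>2"
    unfolding Xr Yr by (simp add: power_mult_distrib flip: distrib_left)
  have "\<bar>X * cos \<psi> - Y * sin \<psi>\<bar> *
      \<bar>c * (X * cos \<psi> - Y * sin \<psi>) + s * (X * sin \<psi> + Y * cos \<psi>)\<bar>
    = r\<^sup>2 * (\<bar>c + cos (2 * (\<psi> + d))\<bar> / 2)" for \<psi>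
  proof -
    have 1: "X * cos \<psi> - Y * sin \<psi> = r * cos (\<psi> + d + h)"
      by (simp add: Xr Yr cos_add sin_add algebra_simps)
    have 2: "X * sin \<psi> + Y * cos \<psi> = r * sin (\<psi> + d + h)"
      by (simp add: Xr Yr cos_add sin_add algebra_simps)
    have 3: "c * (r * cos (\<psi> + d + h)) + s * (r * sin (\<psi> + d + h)) = r * cos (\<psi> + d - h)"
    proof -
      have "cos (\<psi> + d - h) = cos ((\<psi> + d + h) - w)" by (simp add: h_def)
      also have "\<dots> = cos (\<psi> + d + h) * cos w + sin (\<psi> + d + h) * sin w"
        by (rule cos_diff)
      finally show ?thesis unfolding w by (simp add: algebra_simps)
    qed
    have 4: "cos (\<psi> + d + h) * cos (\<psi> + d - h) = (c + cos (2 * (\<psi> + d))) / 2"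
      by (simp add: cos_times_cos w h_def)
    have "\<bar>X * cos \<psi> - Y * sin \<psi>\<bar> *
      \<bar>c * (X * cos \<psi> - Y * sin \<psi>) + s * (X * sin \<psi> + Y * cos \<psi>)\<bar>
      = \<bar>r * r * (cos (\<psi> + d + h) * cos (\<psi> + d - h))\<bar>"
      unfolding 1 2 3 by (simp add: abs_mult)
    also have "\<dots> = r\<^sup>2 * (\<bar>c + cos (2 * (\<psi> + d))\<bar> / 2)"
      unfolding 4 by (simp add: abs_mult power2_eq_square)
    finally show ?thesis .
  qed
  then have "integral {0..pi} (\<lambda>\<psi>. \<bar>X * cos \<psi> - Y * sin \<psi>\<bar> *
      \<bar>c * (X * cos \<psi> - Y * sin \<psi>) + s * (X * sin \<psi> + Y * cos \<psi>)\<bar>)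
    = r\<^sup>2 * integral {0..pi} (\<lambda>\<psi>. \<bar>c + cos (2 * (\<psi> + d))\<bar> / 2)"
    by (simp only: integral_mult_right)
  also have "\<dots> = r\<^sup>2 * arc_kernel c"
    using integral_abs_shifted_cos_phase[OF _ d, of c] by (simp add: w)
  finally show ?thesis by (simp only: r2)
qed

section \<open>Inner products and rotations of a plane\<close>

lemma vinner_commute: "vinner n x y = vinner n y x"
  by (simp add: vinner_def mult.commute)

lemma vinner_self: "vinner n x x = (vnorm n x)\<^sup>2"
  by (simp add: vinner_def L2_set_def power2_eq_square sum_nonneg)

lemma vinner_self_unit: "vnorm n x = 1 \<Longrightarrow> vinner n x x = 1"
  by (simp add: vinner_self)

lemma vinner_lincomb:
  assumes "\<And>i. i < n \<Longrightarrow> x i = a * y i + b * z i"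
  shows "vinner n x w = a * vinner n y w + b * vinner n z w"
  using assms by (simp add: vinner_def sum_distrib_left distrib_right mult.assoc flip: sum.distrib)

lemma abs_vinner_le: "\<bar>vinner n x y\<bar> \<le> vnorm n x * vnorm n y"
proof -
  have "\<bar>vinner n x y\<bar> \<le> (\<Sum>i<n. \<bar>x i\<bar> * \<bar>y i\<bar>)"
    unfolding vinner_def by (rule order.trans[OF sum_abs]) (simp add: abs_mult)
  also have "\<dots> \<le> vnorm n x * vnorm n y" by (rule L2_set_mult_ineq)
  finally show ?thesis .
qed

lemma measurable_vinner [measurable (raw)]:
  assumes "f \<in> measurable M (Rn n)" "g \<in> measurable M (Rn n)"
  shows "(\<lambda>x. vinner n (f x) (g x)) \<in> borel_measurable M"
  unfolding vinner_def
  by (intro borel_measurable_sum borel_measurable_times measurable_coord[OF assms(1)] measurable_coord[OF assms(2)]) auto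

lemma measurable_vinner_const [measurable (raw)]:
  assumes "f \<in> measurable M (Rn n)"
  shows "(\<lambda>x. vinner n u (f x)) \<in> borel_measurable M"
  unfolding vinner_def
  by (intro borel_measurable_sum borel_measurable_times measurable_coord[OF assms] borel_measurable_const) auto

definition basis_vector :: "nat \<Rightarrow> nat \<Rightarrow> real" where
  "basis_vector i j = (if i = j then 1 else 0)"

lemma vinner_basis_vector: "i < n \<Longrightarrow> vinner n (basis_vector i) x = x i"
  by (simp add: vinner_def basis_vector_def if_distrib[of "\<lambda>a. a * _"] cong: if_cong)

definition orthonormal_pair :: "nat \<Rightarrow> (nat \<Rightarrow> real) \<Rightarrow> (nat \<Rightarrow> real) \<Rightarrow> bool" where
  "orthonormal_pair n p q \<longleftrightarrow> vinner n p p = 1 \<and> vinner n q q = 1 \<and> vinner n p q = 0"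

text \<open>The matrix of the rotation with cosine \<open>c\<close> and sine \<open>s\<close> in the plane of the orthonormal
  vectors \<open>p\<close> and \<open>q\<close>, which fixes the orthogonal complement of this plane.  Writing it down
  explicitly avoids completing \<open>p, q\<close> to an orthonormal basis.\<close>

definition plane_rotation ::
    "(nat \<Rightarrow> real) \<Rightarrow> (nat \<Rightarrow> real) \<Rightarrow> real \<Rightarrow> real \<Rightarrow> nat \<Rightarrow> nat \<Rightarrow> real" where
  "plane_rotation p q c s i j = (if i = j then 1 else 0)
    + ((c - 1) * p i + s * q i) * p j + ((c - 1) * q i - s * p i) * q j"

text \<open>The transpose is the rotation by the opposite angle, so orthogonality of the rows for every angle
  yields orthogonality of the columns.\<close>

lemma plane_rotation_transpose: "plane_rotation p q c s j i = plane_rotation p q c (- s) i j"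
  by (simp add: plane_rotation_def algebra_simps)

lemma orthogonal_plane_rotation:
  assumes pq: "orthonormal_pair n p q" and cs: "c\<^sup>2 + s\<^sup>2 = 1"
  shows "orthogonal_mat n (plane_rotation p q c s)"
proof -
  have rows: "(\<Sum>k<n. plane_rotation p q c s i k * plane_rotation p q c s j k) = (if i = j then 1 else 0)"
    if cs: "c\<^sup>2 + s\<^sup>2 = 1" and ij: "i < n" "j < n" for s i j
  proof -
    let ?D = "\<lambda>i k :: nat. (if i = k then 1 else 0 :: real)"
    define A B C E where "A = (c - 1) * p i + s * q i" and "B = (c - 1) * q i - s * p i"
      and "C = (c - 1) * p j + s * q j" and "E = (c - 1) * q j - s * p j"
    have D: "(\<Sum>k<n. ?D i k * x k) = x i" if "i < n" for i x
      using that by (simp add: if_distrib[of "\<lambda>a. a * _"] cong: if_cong)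
    have pp: "(\<Sum>k<n. p k * p k) = 1" "(\<Sum>k<n. q k * q k) = 1" "(\<Sum>k<n. p k * q k) = 0"
      using pq by (auto simp: orthonormal_pair_def vinner_def)
    have "(\<Sum>k<n. plane_rotation p q c s i k * plane_rotation p q c s j k) =
      (\<Sum>k<n. ?D i k * ?D j k + C * (?D i k * p k) + E * (?D i k * q k)
         + A * (?D j k * p k) + B * (?D j k * q k)
         + A * C * (p k * p k) + B * E * (q k * q k) + (A * E + B * C) * (p k * q k))"
      unfolding plane_rotation_def A_def[symmetric] B_def[symmetric] C_def[symmetric] E_def[symmetric]
      by (intro sum.cong refl) algebra
    also have "\<dots> = ?D j i + C * p i + E * q i + A * p j + B * q j + A * C + B * E"
      using ij by (simp only: sum.distrib sum_distrib_left[symmetric] D pp mult_1_right mult_zero_right add_0_right)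
    \<comment> \<open>All terms other than the Kronecker symbol collect into a multiple of \<open>c\<^sup>2 + s\<^sup>2 - 1\<close>.\<close>
    also have "\<dots> = ?D i j + (c\<^sup>2 + s\<^sup>2 - 1) * (p i * p j + q i * q j)"
      unfolding A_def B_def C_def E_def by (simp only: eq_commute[of j i]) algebra
    finally show ?thesis by (simp add: cs)
  qed
  have "(\<Sum>k<n. plane_rotation p q c s k i * plane_rotation p q c s k j) = (if i = j then 1 else 0)"
    if "i < n" "j < n" for i j
    unfolding plane_rotation_transpose[of p q c s] using rows[of "- s" i j] that cs by simp
  with rows[OF cs] show ?thesis by (simp add: orthogonal_mat_def)
qed

lemma vapp_plane_rotation:
  assumes "i < n"
  shows "vapp n (plane_rotation p q c s) x i =
    x i + ((c - 1) * p i + s * q i) * vinner n p x + ((c - 1) * q i - s * p i) * vinner n q x"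
proof -
  have "(\<Sum>j<n. (if i = j then 1 else 0) * x j) = x i"
    using assms by (simp add: if_distrib[of "\<lambda>a. a * _"] cong: if_cong)
  then show ?thesis
    using assms
    by (simp add: vapp_def plane_rotation_def vinner_def distrib_right sum.distrib sum_distrib_left mult.assoc)
qed

lemma vinner_plane_rotation:
  assumes "orthonormal_pair n p q"
  shows "vinner n p (vapp n (plane_rotation p q c s) x) = c * vinner n p x - s * vinner n q x"
    and "vinner n q (vapp n (plane_rotation p q c s) x) = s * vinner n p x + c * vinner n q x"
proof -
  have pq: "vinner n p p = 1" "vinner n q q = 1" "vinner n p q = 0" "vinner n q p = 0"
    using assms by (auto simp: orthonormal_pair_def vinner_commute)
  define P Q where "P = vinner n p x" and "Q = vinner n q x"
  have eq: "vinner n y (vapp n (plane_rotation p q c s) x) = vinner n y x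
      + ((c - 1) * vinner n y p + s * vinner n y q) * P + ((c - 1) * vinner n y q - s * vinner n y p) * Q" for y
  proof -
    have "vinner n y (vapp n (plane_rotation p q c s) x) =
      (\<Sum>i<n. y i * x i + ((c - 1) * P - s * Q) * (y i * p i) + (s * P + (c - 1) * Q) * (y i * q i))"
      unfolding vinner_def[of n y "vapp n _ x"]
      by (intro sum.cong refl) (simp add: vapp_plane_rotation P_def Q_def algebra_simps)
    also have "\<dots> = vinner n y x + ((c - 1) * P - s * Q) * vinner n y p + (s * P + (c - 1) * Q) * vinner n y q"
      by (simp add: sum.distrib sum_distrib_left[symmetric] vinner_def)
    finally show ?thesis by (simp add: algebra_simps)
  qed
  show "vinner n p (vapp n (plane_rotation p q c s) x) = c * vinner n p x - s * vinner n q x"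
    "vinner n q (vapp n (plane_rotation p q c s) x) = s * vinner n p x + c * vinner n q x"
    unfolding eq by (simp_all add: pq P_def Q_def algebra_simps)
qed

text \<open>One Gram-Schmidt step.  When \<open>v\<close> is parallel to \<open>u\<close> there may be no unit vector orthogonal to
  \<open>u\<close> (in dimension one there is none), so \<open>q\<close> is only constrained for \<open>s \<noteq> 0\<close>.\<close>

lemma unit_vector_decomposition:
  assumes u: "vnorm n u = 1" and v: "vnorm n v = 1"
  obtains q s where "(vinner n u v)\<^sup>2 + s\<^sup>2 = 1"
    "\<And>x. vinner n v x = vinner n u v * vinner n u x + s * vinner n q x"
    "s \<noteq> 0 \<Longrightarrow> orthonormal_pair n u q"
proof -
  define t where "t = vinner n u v"
  define w where "w = (\<lambda>i. 1 * v i + (- t) * u i)"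
  define s where "s = vnorm n w"
  define q where "q = (\<lambda>i. (1 / s) * w i + 0 * w i)"
  have w: "vinner n w x = vinner n v x - t * vinner n u x" for x
    using vinner_lincomb[of n w 1 v "- t" u x] by (simp add: w_def)
  have q: "vinner n q x = vinner n w x / s" for x
    using vinner_lincomb[of n q "1 / s" w 0 w x] by (simp add: q_def)
  have ts: "t\<^sup>2 + s\<^sup>2 = 1"
  proof -
    have "s\<^sup>2 = vinner n v w - t * vinner n u w"
      unfolding s_def vinner_self[symmetric] by (rule w)
    also have "vinner n v w = 1 - t * t"
      unfolding vinner_commute[of n v w] w vinner_self_unit[OF v] by (simp add: t_def)
    also have "vinner n u w = 0"
      unfolding vinner_commute[of n u w] w vinner_self_unit[OF u] by (simp add: t_def vinner_commute[of n v u])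
    finally show ?thesis by (simp add: power2_eq_square)
  qed
  have "vinner n v x = t * vinner n u x + s * vinner n q x" for x
  proof (cases "s = 0")
    case True
    then have "\<forall>i\<in>{..<n}. w i = 0" by (simp add: s_def L2_set_eq_0_iff)
    then have "vinner n w x = 0" by (simp add: vinner_def)
    with True show ?thesis using w[of x] by simp
  next
    case False
    then show ?thesis using w[of x] by (simp add: q)
  qed
  moreover have "orthonormal_pair n u q" if "s \<noteq> 0"
  proof -
    have "vinner n q q = 1"
      unfolding q vinner_commute[of n w q] using that by (simp add: q vinner_self power2_eq_square flip: s_def)
    moreover have "vinner n u q = 0"
      unfolding vinner_commute[of n u q] q w vinner_self_unit[OF u] by (simp add: t_def vinner_commute[of n v u])
    ultimately show ?thesis by (simp add: orthonormal_pair_def vinner_self_unit[OF u])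
  qed
  ultimately show ?thesis using that ts unfolding t_def by blast
qed

section \<open>Integration on products\<close>

lemma (in pair_sigma_finite) integrable_pair_mult:
  fixes f g :: "_ \<Rightarrow> real"
  assumes f: "integrable M1 f" and g: "integrable M2 g"
  shows "integrable (M1 \<Otimes>\<^sub>M M2) (\<lambda>(x, y). f x * g y)"
proof (rule Fubini_integrable)
  note [measurable] = borel_measurable_integrable[OF f] borel_measurable_integrable[OF g]
  show "(\<lambda>(x, y). f x * g y) \<in> borel_measurable (M1 \<Otimes>\<^sub>M M2)" by measurable
  show "integrable M1 (\<lambda>x. \<integral>y. norm (case (x, y) of (x, y) \<Rightarrow> f x * g y) \<partial>M2)"
    using f by (simp add: abs_mult)
  show "AE x in M1. integrable M2 (\<lambda>y. case (x, y) of (x, y) \<Rightarrow> f x * g y)"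
    using g by simp
qed

lemma (in pair_sigma_finite) integral_pair_mult:
  fixes f g :: "_ \<Rightarrow> real"
  assumes "integrable M1 f" "integrable M2 g"
  shows "(\<integral>(x, y). f x * g y \<partial>(M1 \<Otimes>\<^sub>M M2)) = (\<integral>x. f x \<partial>M1) * (\<integral>y. g y \<partial>M2)"
  using integral_fst'[OF integrable_pair_mult[OF assms]] by simp

lemma (in pair_sigma_finite) integrable_pair_bound:
  fixes f :: "_ \<Rightarrow> _ \<Rightarrow> real"
  assumes "case_prod f \<in> borel_measurable (M1 \<Otimes>\<^sub>M M2)" "integrable M1 g" "integrable M2 h"
    and "\<And>x y. \<bar>f x y\<bar> \<le> g x * h y"
  shows "integrable (M1 \<Otimes>\<^sub>M M2) (case_prod f)"
proof (rule Bochner_Integration.integrable_bound[OF integrable_pair_mult[OF assms(2,3)] assms(1)])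
  show "AE p in M1 \<Otimes>\<^sub>M M2. norm (case_prod f p) \<le> norm (case p of (x, y) \<Rightarrow> g x * h y)"
    by (intro AE_I2) (auto intro: order.trans[OF assms(4)])
qed

section \<open>Second moments on the sphere\<close>

lemma integrable_sphere_bounded:
  fixes f :: "(nat \<Rightarrow> real) \<Rightarrow> real"
  assumes n: "n \<ge> 1" and [measurable]: "f \<in> borel_measurable (Rn n)"
    and bound: "\<And>\<theta>. vnorm n \<theta> = 1 \<Longrightarrow> \<bar>f \<theta>\<bar> \<le> B"
  shows "integrable (sphere_measure n) f"
proof -
  interpret S: prob_space "sphere_measure n" by (rule prob_space_sphere_measure)
  show ?thesis
  proof (rule S.integrable_const_bound)
    show "AE \<theta> in sphere_measure n. norm (f \<theta>) \<le> B"
      using AE_sphere_measure[OF n] by eventually_elim (simp add: bound)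
  qed simp
qed

lemma integrable_sphere_vinner:
  assumes "n \<ge> 1"
  shows "integrable (sphere_measure n) (\<lambda>\<theta>. \<bar>vinner n x \<theta>\<bar>)"
    and "integrable (sphere_measure n) (\<lambda>\<theta>. vinner n x \<theta> * vinner n y \<theta>)"
proof -
  show "integrable (sphere_measure n) (\<lambda>\<theta>. \<bar>vinner n x \<theta>\<bar>)"
    by (rule integrable_sphere_bounded[OF assms, of _ "vnorm n x"])
       (auto intro: order.trans[OF abs_vinner_le])
  show "integrable (sphere_measure n) (\<lambda>\<theta>. vinner n x \<theta> * vinner n y \<theta>)"
  proof (rule integrable_sphere_bounded[OF assms, of _ "vnorm n x * vnorm n y"])
    fix \<theta> :: "nat \<Rightarrow> real" assume "vnorm n \<theta> = 1"
    then have "\<bar>vinner n x \<theta>\<bar> \<le> vnorm n x" "\<bar>vinner n y \<theta>\<bar> \<le> vnorm n y"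
      using abs_vinner_le[of n x \<theta>] abs_vinner_le[of n y \<theta>] by auto
    then show "\<bar>vinner n x \<theta> * vinner n y \<theta>\<bar> \<le> vnorm n x * vnorm n y"
      unfolding abs_mult by (intro mult_mono) auto
  qed measurable
qed

lemma sphere_integral_rotate:
  fixes f :: "(nat \<Rightarrow> real) \<Rightarrow> real"
  assumes "f \<in> borel_measurable (Rn n)" "orthogonal_mat n U"
  shows "(\<integral>\<theta>. f (vapp n U \<theta>) \<partial>sphere_measure n) = (\<integral>\<theta>. f \<theta> \<partial>sphere_measure n)"
proof -
  have "(\<integral>\<theta>. f \<theta> \<partial>sphere_measure n) = (\<integral>\<theta>. f \<theta> \<partial>distr (sphere_measure n) (Rn n) (vapp n U))"
    by (simp add: sphere_measure_rotation_invariant[OF assms(2)])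
  also have "\<dots> = (\<integral>\<theta>. f (vapp n U \<theta>) \<partial>sphere_measure n)"
    using assms(1) by (intro integral_distr) auto
  finally show ?thesis by simp
qed

text \<open>The pair of coordinates \<open>(p \<cdot> \<theta>, q \<cdot> \<theta>)\<close> of a uniform point of the sphere has a rotation
  invariant law in the plane.  All the information on the uniform measure used below comes from
  this invariance and from \<open>\<bar>\<theta>\<bar> = 1\<close>.\<close>

lemma sphere_integral_plane_rotation:
  assumes pq: "orthonormal_pair n p q" and cs: "c\<^sup>2 + s\<^sup>2 = 1"
    and f: "case_prod f \<in> borel_measurable (borel \<Otimes>\<^sub>M borel)"
  shows "(\<integral>\<theta>. f (c * vinner n p \<theta> - s * vinner n q \<theta>) (s * vinner n p \<theta> + c * vinner n q \<theta>) \<partial>sphere_measure n)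
    = (\<integral>\<theta>. (f (vinner n p \<theta>) (vinner n q \<theta>) :: real) \<partial>sphere_measure n)"
proof -
  have "(\<lambda>\<theta>. case_prod f (vinner n p \<theta>, vinner n q \<theta>)) \<in> borel_measurable (Rn n)"
    by (rule measurable_compose[OF _ f]) measurable
  then show ?thesis
    using sphere_integral_rotate[of "\<lambda>\<theta>. f (vinner n p \<theta>) (vinner n q \<theta>)" n, OF _ orthogonal_plane_rotation[OF pq cs]]
    by (simp add: vinner_plane_rotation[OF pq])
qed

text \<open>Rotation by a right angle maps \<open>(x, y)\<close> to \<open>(- y, x)\<close>: it exchanges the two squares and
  reverses the sign of the product.\<close>

lemma sphere_integral_orthonormal:
  assumes pq: "orthonormal_pair n p q"
  shows "(\<integral>\<theta>. (vinner n q \<theta>)\<^sup>2 \<partial>sphere_measure n) = (\<integral>\<theta>. (vinner n p \<theta>)\<^sup>2 \<partial>sphere_measure n)"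
    and "(\<integral>\<theta>. vinner n p \<theta> * vinner n q \<theta> \<partial>sphere_measure n) = 0"
proof -
  show "(\<integral>\<theta>. (vinner n q \<theta>)\<^sup>2 \<partial>sphere_measure n) = (\<integral>\<theta>. (vinner n p \<theta>)\<^sup>2 \<partial>sphere_measure n)"
    using sphere_integral_plane_rotation[OF pq, of 0 1 "\<lambda>x y. x\<^sup>2"] by simp
  have "(\<integral>\<theta>. - (vinner n q \<theta> * vinner n p \<theta>) \<partial>sphere_measure n) =
      (\<integral>\<theta>. vinner n p \<theta> * vinner n q \<theta> \<partial>sphere_measure n)"
    using sphere_integral_plane_rotation[OF pq, of 0 1 "\<lambda>x y. x * y"] by simp
  then show "(\<integral>\<theta>. vinner n p \<theta> * vinner n q \<theta> \<partial>sphere_measure n) = 0"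
    by (simp add: mult.commute)
qed

text \<open>The second moments of distinct coordinates are exchanged by a rotation, hence equal, and they
  add up to the mean of \<open>\<bar>\<theta>\<bar>\<^sup>2 = 1\<close>.\<close>

lemma sphere_integral_coords:
  assumes n: "n \<ge> 1" and ij: "i < n" "j < n"
  shows "(\<integral>\<theta>. \<theta> i * \<theta> j \<partial>sphere_measure n) = (if i = j then 1 / real n else 0)"
proof -
  interpret S: prob_space "sphere_measure n" by (rule prob_space_sphere_measure)
  let ?e = basis_vector
  note e = vinner_basis_vector
  have on: "orthonormal_pair n (?e i) (?e j)" if "i < n" "j < n" "i \<noteq> j" for i j
    using that by (auto simp: orthonormal_pair_def e) (auto simp: basis_vector_def)
  have int: "integrable (sphere_measure n) (\<lambda>\<theta>. (\<theta> k)\<^sup>2)" if "k < n" for k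
    using integrable_sphere_vinner(2)[OF n, of "?e k" "?e k"] that by (simp add: e power2_eq_square)
  show ?thesis
  proof (cases "i = j")
    case True
    have eq: "(\<integral>\<theta>. (\<theta> k)\<^sup>2 \<partial>sphere_measure n) = (\<integral>\<theta>. (\<theta> i)\<^sup>2 \<partial>sphere_measure n)" if "k < n" for k
      using sphere_integral_orthonormal(1)[OF on[of i k]] that ij by (cases "k = i") (auto simp: e)
    have "real n * (\<integral>\<theta>. (\<theta> i)\<^sup>2 \<partial>sphere_measure n) = (\<Sum>k<n. \<integral>\<theta>. (\<theta> k)\<^sup>2 \<partial>sphere_measure n)"
      by (simp add: eq)
    also have "\<dots> = (\<integral>\<theta>. (\<Sum>k<n. (\<theta> k)\<^sup>2) \<partial>sphere_measure n)"
      by (rule Bochner_Integration.integral_sum[symmetric]) (simp add: int)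
    also have "\<dots> = (\<integral>\<theta>. 1 \<partial>sphere_measure n)"
    proof (rule integral_cong_AE)
      show "AE \<theta> in sphere_measure n. (\<Sum>k<n. (\<theta> k)\<^sup>2) = 1"
        using AE_sphere_measure[OF n] by eventually_elim (simp add: L2_set_def)
      show "(\<lambda>\<theta>. \<Sum>k<n. (\<theta> k)\<^sup>2) \<in> borel_measurable (sphere_measure n)"
        using int by (intro borel_measurable_sum borel_measurable_integrable) auto
    qed simp
    also have "\<dots> = 1" using S.prob_space by simp
    finally show ?thesis using n True by (simp add: power2_eq_square field_simps)
  next
    case False
    then show ?thesis
      using sphere_integral_orthonormal(2)[OF on[OF ij False]] ij by (simp add: e)
  qed
qed

lemma sphere_integral_vinner_square:
  assumes n: "n \<ge> 1"
  shows "(\<integral>\<theta>. (vinner n x \<theta>)\<^sup>2 \<partial>sphere_measure n) = (vnorm n x)\<^sup>2 / real n"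
proof -
  let ?e = basis_vector
  note e = vinner_basis_vector
  have int: "integrable (sphere_measure n) (\<lambda>\<theta>. \<theta> i * \<theta> j)" if "i < n" "j < n" for i j
    using integrable_sphere_vinner(2)[OF n, of "?e i" "?e j"] that by (simp add: e)
  have "(\<integral>\<theta>. (vinner n x \<theta>)\<^sup>2 \<partial>sphere_measure n) =
      (\<integral>\<theta>. (\<Sum>i<n. \<Sum>j<n. (x i * x j) * (\<theta> i * \<theta> j)) \<partial>sphere_measure n)"
    by (simp add: vinner_def power2_eq_square sum_product mult_ac)
  also have "\<dots> = (\<Sum>i<n. \<Sum>j<n. (x i * x j) * (\<integral>\<theta>. \<theta> i * \<theta> j \<partial>sphere_measure n))"
    by (subst Bochner_Integration.integral_sum, use int in force)
       (intro sum.cong refl, subst Bochner_Integration.integral_sum, use int in auto)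
  also have "\<dots> = (\<Sum>i<n. \<Sum>j<n. if i = j then x i * x j / real n else 0)"
    by (intro sum.cong refl) (auto simp: sphere_integral_coords[OF n])
  also have "\<dots> = (vnorm n x)\<^sup>2 / real n"
    unfolding vinner_self[symmetric] by (simp add: sum_divide_distrib vinner_def)
  finally show ?thesis .
qed

section \<open>The mean of products of absolute marginals\<close>

text \<open>Rotating \<open>\<theta>\<close> by an angle \<open>\<psi>\<close> in the plane of \<open>p\<close> and \<open>q\<close> does not change the integral, so it may
  be averaged over \<open>\<psi> \<in> {0..pi}\<close>.  After exchanging the integrals, the average over \<open>\<psi>\<close> is the
  planar integral \<open>integral_rotated_product\<close>, and what remains are second moments of \<open>\<theta>\<close>.\<close>

lemma sphere_integral_abs_product_orthonormal:
  assumes n: "n \<ge> 1" and pq: "orthonormal_pair n p q" and cs: "c\<^sup>2 + s\<^sup>2 = 1"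
  shows "(\<integral>\<theta>. \<bar>vinner n p \<theta>\<bar> * \<bar>c * vinner n p \<theta> + s * vinner n q \<theta>\<bar> \<partial>sphere_measure n)
    = 2 / (pi * real n) * arc_kernel c"
proof -
  interpret S: prob_space "sphere_measure n" by (rule prob_space_sphere_measure)
  define N where "N = restrict_space lborel {0..pi}"
  have N: "finite_measure N"
    by (rule finite_measureI) (simp add: N_def emeasure_restrict_space space_restrict_space)
  interpret N: finite_measure N by (rule N)
  interpret P: pair_sigma_finite N "sphere_measure n" ..
  have idN [measurable]: "(\<lambda>\<psi>. \<psi>) \<in> borel_measurable N"
    unfolding N_def by (rule measurable_restrict_space1) simp
  define K where "K = (\<lambda>\<psi> \<theta>. \<bar>vinner n p \<theta> * cos \<psi> - vinner n q \<theta> * sin \<psi>\<bar> *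
      \<bar>c * (vinner n p \<theta> * cos \<psi> - vinner n q \<theta> * sin \<psi>)
        + s * (vinner n p \<theta> * sin \<psi> + vinner n q \<theta> * cos \<psi>)\<bar>)"
  define L where "L = (\<integral>\<theta>. \<bar>vinner n p \<theta>\<bar> * \<bar>c * vinner n p \<theta> + s * vinner n q \<theta>\<bar> \<partial>sphere_measure n)"
  have meas: "case_prod K \<in> borel_measurable (N \<Otimes>\<^sub>M sphere_measure n)"
    unfolding K_def by measurable
  have rot: "(\<integral>\<theta>. K \<psi> \<theta> \<partial>sphere_measure n) = L" for \<psi>
    using sphere_integral_plane_rotation[OF pq, of "cos \<psi>" "sin \<psi>" "\<lambda>x y. \<bar>x\<bar> * \<bar>c * x + s * y\<bar>"]
    by (simp add: K_def L_def mult.commute)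
  have K0: "0 \<le> K \<psi> \<theta>" for \<psi> \<theta> by (simp add: K_def)
  have Kint: "integrable (sphere_measure n) (K \<psi>)" for \<psi>
  proof -
    let ?u = "\<lambda>i. cos \<psi> * p i + - sin \<psi> * q i" and ?v = "\<lambda>i. sin \<psi> * p i + cos \<psi> * q i"
    let ?w = "\<lambda>i. c * ?u i + s * ?v i"
    have "K \<psi> \<theta> = \<bar>vinner n ?u \<theta> * vinner n ?w \<theta>\<bar>" for \<theta>
      using vinner_lincomb[of n ?u "cos \<psi>" p "- sin \<psi>" q \<theta>] vinner_lincomb[of n ?v "sin \<psi>" p "cos \<psi>" q \<theta>]
        vinner_lincomb[of n ?w c ?u s ?v \<theta>] by (simp add: K_def abs_mult mult.commute)
    then have "K \<psi> = (\<lambda>\<theta>. \<bar>vinner n ?u \<theta> * vinner n ?w \<theta>\<bar>)" ..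
    then show ?thesis
      using integrable_abs[OF integrable_sphere_vinner(2)[OF n, of ?u ?w]] by simp
  qed
  have int: "integrable (N \<Otimes>\<^sub>M sphere_measure n) (case_prod K)"
    by (rule P.Fubini_integrable[OF meas]) (simp_all add: K0 rot Kint)
  have inner: "(\<integral>\<psi>. K \<psi> \<theta> \<partial>N) = ((vinner n p \<theta>)\<^sup>2 + (vinner n q \<theta>)\<^sup>2) * arc_kernel c" for \<theta>
  proof -
    have "continuous_on {0..pi} (\<lambda>\<psi>. K \<psi> \<theta>)" unfolding K_def by (intro continuous_intros)
    then have "set_integrable lborel {0..pi} (\<lambda>\<psi>. K \<psi> \<theta>)" by (rule borel_integrable_atLeastAtMost')
    then have "(\<integral>\<psi>. K \<psi> \<theta> \<partial>N) = integral {0..pi} (\<lambda>\<psi>. K \<psi> \<theta>)"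
      unfolding N_def by (simp add: integral_restrict_space set_borel_integral_eq_integral(2)[symmetric]
        set_lebesgue_integral_def)
    also have "\<dots> = ((vinner n p \<theta>)\<^sup>2 + (vinner n q \<theta>)\<^sup>2) * arc_kernel c"
      unfolding K_def by (rule integral_rotated_product[OF cs])
    finally show ?thesis .
  qed
  have sq: "integrable (sphere_measure n) (\<lambda>\<theta>. (vinner n x \<theta>)\<^sup>2)" for x
    using integrable_sphere_vinner(2)[OF n, of x x] by (simp add: power2_eq_square)
  have "pi * L = (\<integral>\<psi>. (\<integral>\<theta>. K \<psi> \<theta> \<partial>sphere_measure n) \<partial>N)"
    by (simp add: rot N_def measure_restrict_space)
  also have "\<dots> = (\<integral>\<theta>. (\<integral>\<psi>. K \<psi> \<theta> \<partial>N) \<partial>sphere_measure n)"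
    by (rule P.Fubini_integral[OF int, symmetric])
  also have "\<dots> = (1 / real n + 1 / real n) * arc_kernel c"
  proof -
    have "(vnorm n p)\<^sup>2 = 1" "(vnorm n q)\<^sup>2 = 1"
      using pq by (simp_all add: orthonormal_pair_def vinner_self)
    then show ?thesis
      unfolding inner by (simp add: sq sphere_integral_vinner_square[OF n])
  qed
  finally show ?thesis unfolding L_def[symmetric] using n by (simp add: field_simps)
qed

text \<open>The kernel formula for arbitrary unit vectors.  In the parallel case it reduces to the second
  moment \<open>1 / n\<close>, in accordance with \<open>arc_kernel 1 = pi / 2\<close>.\<close>

lemma sphere_integral_abs_product:
  assumes n: "n \<ge> 1" and u: "vnorm n u = 1" and v: "vnorm n v = 1"
  shows "(\<integral>\<theta>. \<bar>vinner n u \<theta>\<bar> * \<bar>vinner n v \<theta>\<bar> \<partial>sphere_measure n)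
    = 2 / (pi * real n) * arc_kernel (vinner n u v)"
proof -
  obtain q s where cs: "(vinner n u v)\<^sup>2 + s\<^sup>2 = 1"
    and dec: "\<And>x. vinner n v x = vinner n u v * vinner n u x + s * vinner n q x"
    and on: "s \<noteq> 0 \<Longrightarrow> orthonormal_pair n u q"
    using unit_vector_decomposition[OF u v] by blast
  show ?thesis
  proof (cases "s = 0")
    case False
    show ?thesis
      using sphere_integral_abs_product_orthonormal[OF n on[OF False] cs] by (simp add: dec)
  next
    case True
    define t where "t = vinner n u v"
    from True cs have "t\<^sup>2 = 1" by (simp add: t_def)
    then have "t = 1 \<or> t = - 1" by (simp add: power2_eq_1_iff)
    then have t: "\<bar>t\<bar> = 1" "arc_kernel t = pi / 2"
      using arc_kernel_minus[of 1] by (auto simp: arc_kernel_1)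
    have "(\<integral>\<theta>. \<bar>vinner n u \<theta>\<bar> * \<bar>vinner n v \<theta>\<bar> \<partial>sphere_measure n)
        = (\<integral>\<theta>. (vinner n u \<theta>)\<^sup>2 \<partial>sphere_measure n)"
      using True t by (intro Bochner_Integration.integral_cong refl)
        (simp add: dec abs_mult power2_eq_square flip: t_def)
    also have "\<dots> = 1 / real n" by (simp add: sphere_integral_vinner_square[OF n] u)
    finally show ?thesis using n by (simp add: t flip: t_def)
  qed
qed

lemma sphere_integral_abs_unit_eq:
  assumes u: "vnorm n u = 1" and v: "vnorm n v = 1"
  shows "(\<integral>\<theta>. \<bar>vinner n v \<theta>\<bar> \<partial>sphere_measure n) = (\<integral>\<theta>. \<bar>vinner n u \<theta>\<bar> \<partial>sphere_measure n)"
proof -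
  obtain q s where cs: "(vinner n u v)\<^sup>2 + s\<^sup>2 = 1"
    and dec: "\<And>x. vinner n v x = vinner n u v * vinner n u x + s * vinner n q x"
    and on: "s \<noteq> 0 \<Longrightarrow> orthonormal_pair n u q"
    using unit_vector_decomposition[OF u v] by blast
  show ?thesis
  proof (cases "s = 0")
    case True
    define t where "t = vinner n u v"
    from True cs have "t = 1 \<or> t = - 1" by (simp add: t_def power2_eq_1_iff)
    with True show ?thesis by (auto simp: dec simp flip: t_def)
  next
    case False
    then show ?thesis
      using sphere_integral_plane_rotation[OF on[OF False], of "vinner n u v" "- s" "\<lambda>x y. \<bar>x\<bar>"] cs
      by (simp add: dec)
  qed
qed

text \<open>Averaging the kernel formula over a uniform second direction \<open>\<eta>\<close> gives the square of the mean of
  \<open>\<bar>u \<cdot> \<theta>\<bar>\<close>, because this mean is the same for all unit vectors.  The bound then follows from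
  \<open>arc_kernel t \<ge> 1 + t\<^sup>2 / 2\<close> and the second moment of \<open>u \<cdot> \<eta>\<close>.  In this way no Gamma functions
  are needed, and the bound is exactly the one that cancels against the quadratic part of
  the upper bound \<open>sphere_integral_abs_product_le\<close>.\<close>

lemma sphere_mean_abs_lower:
  assumes n: "n \<ge> 1" and u: "vnorm n u = 1"
  shows "2 / (pi * real n) * (1 + 1 / (2 * real n)) \<le> (\<integral>\<theta>. \<bar>vinner n u \<theta>\<bar> \<partial>sphere_measure n)\<^sup>2"
proof -
  interpret S: prob_space "sphere_measure n" by (rule prob_space_sphere_measure)
  interpret P: pair_sigma_finite "sphere_measure n" "sphere_measure n" ..
  define m where "m = (\<integral>\<theta>. \<bar>vinner n u \<theta>\<bar> \<partial>sphere_measure n)"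
  have ints: "integrable (sphere_measure n) (\<lambda>\<theta>. vnorm n \<theta> * vnorm n \<theta>)"
    "integrable (sphere_measure n) (\<lambda>\<theta>. vnorm n \<theta>)"
    by (rule integrable_sphere_bounded[OF n, of _ 1]; simp; fail)+
  have int: "integrable (sphere_measure n \<Otimes>\<^sub>M sphere_measure n)
      (\<lambda>(\<theta>, \<eta>). \<bar>vinner n u \<theta>\<bar> * \<bar>vinner n \<eta> \<theta>\<bar>)"
  proof (rule P.integrable_pair_bound[OF _ ints])
    fix \<theta> \<eta> :: "nat \<Rightarrow> real"
    have "\<bar>vinner n u \<theta>\<bar> * \<bar>vinner n \<eta> \<theta>\<bar> \<le> vnorm n \<theta> * (vnorm n \<eta> * vnorm n \<theta>)"
      using abs_vinner_le[of n u \<theta>] u by (intro mult_mono abs_vinner_le) auto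
    then show "\<bar>\<bar>vinner n u \<theta>\<bar> * \<bar>vinner n \<eta> \<theta>\<bar>\<bar> \<le> vnorm n \<theta> * vnorm n \<theta> * vnorm n \<eta>"
      by (simp add: mult_ac)
  qed measurable
  let ?k = "2 / (pi * real n)"
  have sq: "integrable (sphere_measure n) (\<lambda>\<theta>. (vinner n u \<theta>)\<^sup>2)"
    using integrable_sphere_vinner(2)[OF n, of u u] by (simp add: power2_eq_square)
  have "?k * (1 + 1 / (2 * real n)) = (\<integral>\<eta>. ?k * (1 + (vinner n u \<eta>)\<^sup>2 / 2) \<partial>sphere_measure n)"
    using sq S.prob_space by (simp add: sphere_integral_vinner_square[OF n] u)
  also have "\<dots> \<le> (\<integral>\<eta>. (\<integral>\<theta>. \<bar>vinner n u \<theta>\<bar> * \<bar>vinner n \<eta> \<theta>\<bar> \<partial>sphere_measure n) \<partial>sphere_measure n)"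
  proof (rule integral_mono_AE)
    show "integrable (sphere_measure n) (\<lambda>\<eta>. ?k * (1 + (vinner n u \<eta>)\<^sup>2 / 2))"
      using sq by simp
    show "integrable (sphere_measure n) (\<lambda>\<eta>. \<integral>\<theta>. \<bar>vinner n u \<theta>\<bar> * \<bar>vinner n \<eta> \<theta>\<bar> \<partial>sphere_measure n)"
      using P.integrable_snd[OF int] .
    show "AE \<eta> in sphere_measure n. ?k * (1 + (vinner n u \<eta>)\<^sup>2 / 2) \<le>
        (\<integral>\<theta>. \<bar>vinner n u \<theta>\<bar> * \<bar>vinner n \<eta> \<theta>\<bar> \<partial>sphere_measure n)"
      using AE_sphere_measure[OF n]
    proof eventually_elim
      case (elim \<eta>)
      then have "\<bar>vinner n u \<eta>\<bar> \<le> 1" using abs_vinner_le[of n u \<eta>] u by simp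
      then have "?k * (1 + (vinner n u \<eta>)\<^sup>2 / 2) \<le> ?k * arc_kernel (vinner n u \<eta>)"
        by (intro mult_left_mono arc_kernel_lower) auto
      then show ?case by (simp only: sphere_integral_abs_product[OF n u elim])
    qed
  qed
  also have "\<dots> = (\<integral>\<theta>. (\<integral>\<eta>. \<bar>vinner n u \<theta>\<bar> * \<bar>vinner n \<eta> \<theta>\<bar> \<partial>sphere_measure n) \<partial>sphere_measure n)"
    by (rule P.Fubini_integral[OF int])
  also have "\<dots> = (\<integral>\<theta>. \<bar>vinner n u \<theta>\<bar> * m \<partial>sphere_measure n)"
  proof (rule integral_cong_AE)
    show "AE \<theta> in sphere_measure n.
        (\<integral>\<eta>. \<bar>vinner n u \<theta>\<bar> * \<bar>vinner n \<eta> \<theta>\<bar> \<partial>sphere_measure n) = \<bar>vinner n u \<theta>\<bar> * m"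
      using AE_sphere_measure[OF n]
    proof eventually_elim
      case (elim \<theta>)
      then show ?case
        using sphere_integral_abs_unit_eq[OF u elim] by (simp add: m_def vinner_commute[of n _ \<theta>])
    qed
  qed measurable
  also have "\<dots> = m\<^sup>2" by (simp add: m_def power2_eq_square)
  finally show ?thesis by (simp add: m_def)
qed

lemma vector_normalization:
  assumes "vnorm n x \<noteq> 0"
  obtains u where "vnorm n u = 1" "\<And>y. vinner n x y = vnorm n x * vinner n u y"
proof -
  define u where "u = (\<lambda>i. (1 / vnorm n x) * x i + 0 * x i)"
  have u: "vinner n u y = vinner n x y / vnorm n x" for y
    using vinner_lincomb[of n u "1 / vnorm n x" x 0 x y] by (simp add: u_def)
  have "(vnorm n u)\<^sup>2 = 1"
    unfolding vinner_self[symmetric] u vinner_commute[of n x u]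
    using assms by (simp add: vinner_self power2_eq_square)
  then have "vnorm n u = 1"
    using L2_set_nonneg[of u "{..<n}"] by (simp add: power2_eq_1_iff)
  with u that[of u] assms show ?thesis by simp
qed

lemma vinner_zero: "vnorm n x = 0 \<Longrightarrow> vinner n x y = 0"
  using abs_vinner_le[of n x y] by simp

text \<open>The homogeneous form of the kernel formula, with the kernel replaced by its upper bound.  The
  three terms are those whose \<open>\<mu>\<close>-averages are known: the first two from \<open>Cov1\<close>, the third from
  the quartic hypothesis.  If one vector vanishes, both sides are \<open>0\<close> since \<open>a / 0 = 0\<close>.\<close>

lemma sphere_integral_abs_product_le:
  assumes n: "n \<ge> 1"
  shows "(\<integral>\<theta>. \<bar>vinner n x \<theta>\<bar> * \<bar>vinner n y \<theta>\<bar> \<partial>sphere_measure n)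
    \<le> 2 / (pi * real n) * (vnorm n x * vnorm n y
        + (vinner n x y)\<^sup>2 / (vnorm n x * vnorm n y) / 2
        + (vinner n x y) ^ 4 / ((vnorm n x) ^ 3 * (vnorm n y) ^ 3))"
proof (cases "vnorm n x = 0 \<or> vnorm n y = 0")
  case True
  then show ?thesis by (auto simp: vinner_zero)
next
  case False
  then have nonzero: "vnorm n x \<noteq> 0" "vnorm n y \<noteq> 0" by simp_all
  obtain u where u: "vnorm n u = 1" "\<And>z. vinner n x z = vnorm n x * vinner n u z"
    using vector_normalization[OF nonzero(1)] by blast
  obtain v where v: "vnorm n v = 1" "\<And>z. vinner n y z = vnorm n y * vinner n v z"
    using vector_normalization[OF nonzero(2)] by blast
  define a b t where "a = vnorm n x" and "b = vnorm n y" and "t = vinner n u v"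
  have ab: "a > 0" "b > 0"
    using nonzero L2_set_nonneg[of _ "{..<n}"] by (auto simp: a_def b_def less_le)
  have xy: "vinner n x y = a * b * t"
    unfolding u(2)[of y] vinner_commute[of n u y] v(2)[of u]
    by (simp add: a_def b_def t_def vinner_commute[of n v u])
  have "\<bar>t\<bar> \<le> 1" using abs_vinner_le[of n u v] u(1) v(1) by (simp add: t_def)
  have "(\<integral>\<theta>. \<bar>vinner n x \<theta>\<bar> * \<bar>vinner n y \<theta>\<bar> \<partial>sphere_measure n)
      = (\<integral>\<theta>. (a * b) * (\<bar>vinner n u \<theta>\<bar> * \<bar>vinner n v \<theta>\<bar>) \<partial>sphere_measure n)"
    using ab by (intro Bochner_Integration.integral_cong refl)
      (simp add: u(2) v(2) abs_mult a_def b_def mult_ac)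
  also have "\<dots> = (a * b) * (2 / (pi * real n) * arc_kernel t)"
    using sphere_integral_abs_product[OF n u(1) v(1)] by (simp add: t_def)
  also have "\<dots> \<le> (a * b) * (2 / (pi * real n) * (1 + t\<^sup>2 / 2 + t ^ 4))"
    using ab by (intro mult_left_mono arc_kernel_upper \<open>\<bar>t\<bar> \<le> 1\<close>) auto
  also have "\<dots> = 2 / (pi * real n) * (a * b + (a * b * t)\<^sup>2 / (a * b) / 2 + (a * b * t) ^ 4 / (a ^ 3 * b ^ 3))"
  proof -
    have "(a * b * t)\<^sup>2 / (a * b) = a * b * t\<^sup>2"
      using ab by (simp add: power2_eq_square)
    moreover have "(a * b * t) ^ 4 / (a ^ 3 * b ^ 3) = a * b * t ^ 4"
      using ab by (simp add: power_mult_distrib power3_eq_cube power4_eq_xxxx)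
    ultimately show ?thesis by (simp only:) (simp add: algebra_simps)
  qed
  finally show ?thesis by (simp only: xy a_def b_def)
qed

section \<open>Moments of an isotropic measure\<close>

text \<open>The standing hypotheses on \<open>\<mu>\<close>; the quartic bound enters only at the very end.\<close>

locale isotropic_measure =
  fixes n :: nat and \<mu> :: "(nat \<Rightarrow> real) measure" and \<alpha> :: real
  assumes dim: "n \<ge> 1" and prob: "borel_prob n \<mu>" and cent: "centered n \<mu>"
    and cov: "\<And>i j. i < n \<Longrightarrow> j < n \<Longrightarrow> Cov1 n \<mu> i j = \<alpha> / sqrt (real n) * (if i = j then 1 else 0)"
begin

lemma sets_mu [simp, measurable_cong]: "sets \<mu> = sets (Rn n)"
  using prob by (simp add: borel_prob_def)

lemma prob_space_mu: "prob_space \<mu>"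
  using prob by (simp add: borel_prob_def)

lemma pair_mu_mu: "pair_sigma_finite \<mu> \<mu>"
  using prob_space_mu by (intro pair_sigma_finite.intro prob_space_imp_sigma_finite)

lemma pair_sphere_mu: "pair_sigma_finite (sphere_measure n) \<mu>"
  using prob_space_mu prob_space_sphere_measure
  by (intro pair_sigma_finite.intro prob_space_imp_sigma_finite)

lemma pair_sphere_mu_mu: "pair_sigma_finite (sphere_measure n) (\<mu> \<Otimes>\<^sub>M \<mu>)"
  by (intro pair_sigma_finite.intro prob_space_imp_sigma_finite prob_space_sphere_measure
      prob_space_pair prob_space_mu)

lemma integrable_vnorm: "integrable \<mu> (vnorm n)"
  using cent by (simp add: centered_def)

lemma integrable_vinner: "integrable \<mu> (\<lambda>x. vinner n x y)"
proof (rule Bochner_Integration.integrable_bound)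
  show "integrable \<mu> (\<lambda>x. vnorm n x * vnorm n y)"
    using integrable_vnorm by simp
  have "(\<lambda>x. vinner n y x) \<in> borel_measurable \<mu>" by measurable
  then show "(\<lambda>x. vinner n x y) \<in> borel_measurable \<mu>" by (simp only: vinner_commute[of n y])
  show "AE x in \<mu>. norm (vinner n x y) \<le> norm (vnorm n x * vnorm n y)"
    by (intro AE_I2) (simp add: abs_mult abs_vinner_le)
qed

lemma abs_coord_le: "i < n \<Longrightarrow> \<bar>x i\<bar> \<le> vnorm n x"
  using member_le_L2_set[of "{..<n}" i "\<lambda>i. \<bar>x i\<bar>"] by (simp add: L2_set_def)

lemma measurable_coord_mu [measurable]: "i < n \<Longrightarrow> (\<lambda>x. x i) \<in> borel_measurable \<mu>"
  using measurable_coord'[of i n] by simp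

lemma integrable_coord: "i < n \<Longrightarrow> integrable \<mu> (\<lambda>x. x i)"
  by (rule Bochner_Integration.integrable_bound[OF integrable_vnorm])
     (auto simp: abs_coord_le)

lemma integrable_Cov1:
  assumes "i < n" "j < n"
  shows "integrable \<mu> (\<lambda>x. x i * x j / vnorm n x)"
proof (rule Bochner_Integration.integrable_bound[OF integrable_vnorm])
  show "(\<lambda>x. x i * x j / vnorm n x) \<in> borel_measurable \<mu>"
    using assms by measurable
  have "\<bar>x i * x j / vnorm n x\<bar> \<le> vnorm n x" for x :: "nat \<Rightarrow> real"
  proof -
    have "\<bar>x i * x j\<bar> \<le> vnorm n x * vnorm n x"
      unfolding abs_mult using assms by (intro mult_mono abs_coord_le) auto
    then have "\<bar>x i * x j\<bar> / vnorm n x \<le> vnorm n x * vnorm n x / vnorm n x"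
      by (intro divide_right_mono) auto
    then show ?thesis by simp
  qed
  then show "AE x in \<mu>. norm (x i * x j / vnorm n x) \<le> norm (vnorm n x)"
    by (intro AE_I2) simp
qed

text \<open>The trace of \<open>Cov1\<close> is the first moment, because \<open>x\<^sub>i\<^sup>2 / \<bar>x\<bar>\<close> sums to \<open>\<bar>x\<bar>\<close>.\<close>

lemma integral_vnorm: "(\<integral>x. vnorm n x \<partial>\<mu>) = \<alpha> * sqrt (real n)"
proof -
  have "vnorm n x = (\<Sum>i<n. x i * x i / vnorm n x)" for x
    using vinner_self[of n x] by (simp add: vinner_def power2_eq_square flip: sum_divide_distrib)
  then have "(\<integral>x. vnorm n x \<partial>\<mu>) = (\<integral>x. (\<Sum>i<n. x i * x i / vnorm n x) \<partial>\<mu>)" by simp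
  also have "\<dots> = (\<Sum>i<n. Cov1 n \<mu> i i)"
    unfolding Cov1_def by (rule Bochner_Integration.integral_sum) (simp add: integrable_Cov1)
  also have "\<dots> = \<alpha> * (real n / sqrt (real n))"
    by (simp add: cov)
  also have "\<dots> = \<alpha> * sqrt (real n)" by (simp add: real_div_sqrt)
  finally show ?thesis .
qed

lemma integrable_pair_dominated:
  assumes [measurable]: "(\<lambda>(x, y). f x y) \<in> borel_measurable (\<mu> \<Otimes>\<^sub>M \<mu>)"
    and "\<And>x y. \<bar>f x y\<bar> \<le> vnorm n x * vnorm n y"
  shows "integrable (\<mu> \<Otimes>\<^sub>M \<mu>) (\<lambda>(x, y). f x y)"
  using pair_sigma_finite.integrable_pair_bound[OF pair_mu_mu assms(1) integrable_vnorm integrable_vnorm assms(2)] .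

lemma integrable_pair_square:
  "integrable (\<mu> \<Otimes>\<^sub>M \<mu>) (\<lambda>(x, y). (vinner n x y)\<^sup>2 / (vnorm n x * vnorm n y))"
proof (rule integrable_pair_dominated)
  fix x y :: "nat \<Rightarrow> real"
  define r where "r = vnorm n x * vnorm n y"
  have r: "r \<ge> 0" by (simp add: r_def)
  have "(vinner n x y)\<^sup>2 \<le> r\<^sup>2"
    using power_mono[OF abs_vinner_le[of n x y], of 2] by (simp add: r_def)
  then have "(vinner n x y)\<^sup>2 / r \<le> r\<^sup>2 / r"
    using r by (intro divide_right_mono) auto
  also have "r\<^sup>2 / r = r" by (simp add: power2_eq_square)
  finally show "\<bar>(vinner n x y)\<^sup>2 / (vnorm n x * vnorm n y)\<bar> \<le> vnorm n x * vnorm n y"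
    using r by (simp add: r_def[symmetric])
qed measurable

lemma integrable_pair_quartic:
  "integrable (\<mu> \<Otimes>\<^sub>M \<mu>) (\<lambda>(x, y). (vinner n x y) ^ 4 / ((vnorm n x) ^ 3 * (vnorm n y) ^ 3))"
proof (rule integrable_pair_dominated)
  fix x y :: "nat \<Rightarrow> real"
  define r where "r = vnorm n x * vnorm n y"
  have r: "r \<ge> 0" by (simp add: r_def)
  have "(vinner n x y) ^ 4 \<le> r ^ 4"
    using power_mono[OF abs_vinner_le[of n x y], of 4] by (simp add: r_def)
  then have "(vinner n x y) ^ 4 / r ^ 3 \<le> r ^ 4 / r ^ 3"
    using r by (intro divide_right_mono) auto
  also have "r ^ 4 / r ^ 3 = r" by (simp add: power3_eq_cube power4_eq_xxxx)
  finally have "\<bar>(vinner n x y) ^ 4 / r ^ 3\<bar> \<le> r" using r by simp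
  then show "\<bar>(vinner n x y) ^ 4 / ((vnorm n x) ^ 3 * (vnorm n y) ^ 3)\<bar> \<le> vnorm n x * vnorm n y"
    by (simp add: r_def power_mult_distrib)
qed measurable

text \<open>The left side is the squared Hilbert-Schmidt norm of \<open>Cov1\<close>: expand \<open>(x \<cdot> y)\<^sup>2\<close> in coordinates and
  integrate over \<open>x\<close> and \<open>y\<close> separately.\<close>

lemma integral_pair_square:
  "(\<integral>(x, y). (vinner n x y)\<^sup>2 / (vnorm n x * vnorm n y) \<partial>(\<mu> \<Otimes>\<^sub>M \<mu>)) = \<alpha>\<^sup>2"
proof -
  define g where "g = (\<lambda>i j (x :: nat \<Rightarrow> real). x i * x j / vnorm n x)"
  have g: "integrable (\<mu> \<Otimes>\<^sub>M \<mu>) (\<lambda>(x, y). g i j x * g i j y)" if "i < n" "j < n" for i j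
    using that unfolding g_def by (intro pair_sigma_finite.integrable_pair_mult[OF pair_mu_mu] integrable_Cov1)
  have eq: "(\<integral>(x, y). g i j x * g i j y \<partial>(\<mu> \<Otimes>\<^sub>M \<mu>)) = (Cov1 n \<mu> i j)\<^sup>2" if "i < n" "j < n" for i j
    unfolding Cov1_def power2_eq_square g_def
    by (intro pair_sigma_finite.integral_pair_mult[OF pair_mu_mu] integrable_Cov1 that)
  have "(vinner n x y)\<^sup>2 / (vnorm n x * vnorm n y) = (\<Sum>i<n. \<Sum>j<n. g i j x * g i j y)" for x y
    by (simp add: vinner_def g_def power2_eq_square sum_product sum_divide_distrib mult_ac)
  then have "(\<integral>(x, y). (vinner n x y)\<^sup>2 / (vnorm n x * vnorm n y) \<partial>(\<mu> \<Otimes>\<^sub>M \<mu>)) =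
      (\<integral>p. (\<Sum>i<n. \<Sum>j<n. (\<lambda>(x, y). g i j x * g i j y) p) \<partial>(\<mu> \<Otimes>\<^sub>M \<mu>))"
    by (simp add: case_prod_unfold)
  also have "\<dots> = (\<Sum>i<n. \<Sum>j<n. (\<integral>(x, y). g i j x * g i j y \<partial>(\<mu> \<Otimes>\<^sub>M \<mu>)))"
  proof (subst Bochner_Integration.integral_sum)
    show "integrable (\<mu> \<Otimes>\<^sub>M \<mu>) (\<lambda>p. \<Sum>j<n. (\<lambda>(x, y). g i j x * g i j y) p)" if "i \<in> {..<n}" for i
      using that by (intro Bochner_Integration.integrable_sum g) auto
    show "(\<Sum>i<n. \<integral>p. (\<Sum>j<n. (\<lambda>(x, y). g i j x * g i j y) p) \<partial>(\<mu> \<Otimes>\<^sub>M \<mu>))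
        = (\<Sum>i<n. \<Sum>j<n. (\<integral>(x, y). g i j x * g i j y \<partial>(\<mu> \<Otimes>\<^sub>M \<mu>)))"
      by (intro sum.cong refl Bochner_Integration.integral_sum g) auto
  qed
  also have "\<dots> = (\<Sum>i<n. \<Sum>j<n. if i = j then \<alpha>\<^sup>2 / real n else 0)"
    by (intro sum.cong refl) (auto simp: eq cov power_divide)
  also have "\<dots> = \<alpha>\<^sup>2" using dim by simp
  finally show ?thesis .
qed

section \<open>The variance of the marginal function\<close>

text \<open>The even part of \<open>2 * Fmu\<close>.  The odd part is a linear function with the barycentre as its
  coefficient vector, so centering removes it (\<open>Fmu_eq_abs_marginal\<close>).\<close>

definition abs_marginal :: "(nat \<Rightarrow> real) \<Rightarrow> real" where
  "abs_marginal \<theta> = (\<integral>x. \<bar>vinner n x \<theta>\<bar> \<partial>\<mu>)"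

lemma Fmu_eq_abs_marginal: "Fmu n \<mu> \<theta> = abs_marginal \<theta> / 2"
proof -
  have "(\<integral>x. vinner n x \<theta> \<partial>\<mu>) = (\<Sum>i<n. (\<integral>x. x i \<partial>\<mu>) * \<theta> i)"
    unfolding vinner_def using integrable_coord by (subst Bochner_Integration.integral_sum) auto
  also have "\<dots> = 0" using cent by (simp add: centered_def)
  finally have 0: "(\<integral>x. vinner n x \<theta> \<partial>\<mu>) = 0" .
  have "Fmu n \<mu> \<theta> = (\<integral>x. (vinner n x \<theta> + \<bar>vinner n x \<theta>\<bar>) / 2 \<partial>\<mu>)"
    unfolding Fmu_def by (intro Bochner_Integration.integral_cong) (auto simp: max_def)
  also have "\<dots> = abs_marginal \<theta> / 2"
    using integrable_vinner[of \<theta>] by (simp add: abs_marginal_def 0)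
  finally show ?thesis .
qed

lemma integrable_sphere_vnorm_power: "integrable (sphere_measure n) (\<lambda>\<theta>. vnorm n \<theta> ^ k)"
  by (rule integrable_sphere_bounded[OF dim, of _ 1]) auto

lemma integrable_abs_marginal_kernel:
  "integrable (sphere_measure n \<Otimes>\<^sub>M \<mu>) (\<lambda>(\<theta>, x). \<bar>vinner n x \<theta>\<bar>)"
proof (rule pair_sigma_finite.integrable_pair_bound[OF pair_sphere_mu _ integrable_sphere_vnorm_power[of 1] integrable_vnorm])
  show "\<bar>\<bar>vinner n x \<theta>\<bar>\<bar> \<le> vnorm n \<theta> ^ 1 * vnorm n x" for x \<theta>
    using abs_vinner_le[of n x \<theta>] by (simp add: mult.commute)
qed measurable

lemma integrable_abs_marginal_square_kernel:
  "integrable (sphere_measure n \<Otimes>\<^sub>M (\<mu> \<Otimes>\<^sub>M \<mu>)) (\<lambda>(\<theta>, p). \<bar>vinner n (fst p) \<theta>\<bar> * \<bar>vinner n (snd p) \<theta>\<bar>)"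
proof (rule pair_sigma_finite.integrable_pair_bound[OF pair_sphere_mu_mu _ integrable_sphere_vnorm_power[of 2]
      pair_sigma_finite.integrable_pair_mult[OF pair_mu_mu integrable_vnorm integrable_vnorm]])
  fix \<theta> :: "nat \<Rightarrow> real" and p :: "(nat \<Rightarrow> real) \<times> (nat \<Rightarrow> real)"
  have "\<bar>vinner n (fst p) \<theta>\<bar> * \<bar>vinner n (snd p) \<theta>\<bar>
      \<le> (vnorm n (fst p) * vnorm n \<theta>) * (vnorm n (snd p) * vnorm n \<theta>)"
    by (intro mult_mono abs_vinner_le) auto
  then show "\<bar>\<bar>vinner n (fst p) \<theta>\<bar> * \<bar>vinner n (snd p) \<theta>\<bar>\<bar>
      \<le> vnorm n \<theta> ^ 2 * (case p of (x, y) \<Rightarrow> vnorm n x * vnorm n y)"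
    by (simp add: case_prod_unfold power2_eq_square mult_ac)
qed measurable

lemma abs_marginal_square: "(abs_marginal \<theta>)\<^sup>2 = (\<integral>p. \<bar>vinner n (fst p) \<theta>\<bar> * \<bar>vinner n (snd p) \<theta>\<bar> \<partial>(\<mu> \<Otimes>\<^sub>M \<mu>))"
proof -
  have i: "integrable \<mu> (\<lambda>x. \<bar>vinner n x \<theta>\<bar>)" using integrable_vinner by simp
  show ?thesis
    using pair_sigma_finite.integral_pair_mult[OF pair_mu_mu i i] by (simp add: abs_marginal_def power2_eq_square case_prod_unfold)
qed

lemma integrable_abs_marginal: "integrable (sphere_measure n) abs_marginal"
  unfolding abs_marginal_def[abs_def] using pair_sigma_finite.integrable_fst[OF pair_sphere_mu integrable_abs_marginal_kernel] .

lemma integrable_abs_marginal_square: "integrable (sphere_measure n) (\<lambda>\<theta>. (abs_marginal \<theta>)\<^sup>2)"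
  unfolding abs_marginal_square using pair_sigma_finite.integrable_fst[OF pair_sphere_mu_mu integrable_abs_marginal_square_kernel] .

text \<open>The mean of \<open>\<bar>x \<cdot> \<theta>\<bar>\<close> over the sphere is \<open>\<bar>x\<bar>\<close> times a constant \<open>m\<close>, so only the first moment of
  \<open>\<mu>\<close> and the lower bound for \<open>m\<^sup>2\<close> are needed.\<close>

lemma mean_abs_marginal_square_lower:
  "2 / (pi * real n) * (\<alpha>\<^sup>2 * real n + \<alpha>\<^sup>2 / 2) \<le> (\<integral>\<theta>. abs_marginal \<theta> \<partial>sphere_measure n)\<^sup>2"
proof -
  define e where "e = basis_vector 0"
  have "vinner n e e = 1"
    using dim by (simp add: e_def vinner_basis_vector) (simp add: basis_vector_def)
  then have e: "vnorm n e = 1"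
    using L2_set_nonneg[of e "{..<n}"] by (simp add: vinner_self power2_eq_1_iff)
  define m where "m = (\<integral>\<theta>. \<bar>vinner n e \<theta>\<bar> \<partial>sphere_measure n)"
  have m: "(\<integral>\<theta>. \<bar>vinner n x \<theta>\<bar> \<partial>sphere_measure n) = vnorm n x * m" for x
  proof (cases "vnorm n x = 0")
    case True
    then show ?thesis by (simp add: vinner_zero)
  next
    case False
    then obtain u where u: "vnorm n u = 1" "\<And>y. vinner n x y = vnorm n x * vinner n u y"
      using vector_normalization by blast
    then show ?thesis
      using sphere_integral_abs_unit_eq[OF e u(1)] by (simp add: u(2) abs_mult m_def)
  qed
  have "(\<integral>\<theta>. abs_marginal \<theta> \<partial>sphere_measure n) = (\<integral>x. (\<integral>\<theta>. \<bar>vinner n x \<theta>\<bar> \<partial>sphere_measure n) \<partial>\<mu>)"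
    unfolding abs_marginal_def by (rule pair_sigma_finite.Fubini_integral[OF pair_sphere_mu integrable_abs_marginal_kernel, symmetric])
  also have "\<dots> = \<alpha> * sqrt (real n) * m"
    by (simp add: m integral_vnorm)
  finally have "(\<integral>\<theta>. abs_marginal \<theta> \<partial>sphere_measure n)\<^sup>2 = (\<alpha>\<^sup>2 * real n) * m\<^sup>2"
    by (simp add: power_mult_distrib)
  moreover have "(\<alpha>\<^sup>2 * real n) * (2 / (pi * real n) * (1 + 1 / (2 * real n))) \<le> (\<alpha>\<^sup>2 * real n) * m\<^sup>2"
    unfolding m_def by (intro mult_left_mono sphere_mean_abs_lower dim e) auto
  moreover have "(\<alpha>\<^sup>2 * real n) * (2 / (pi * real n) * (1 + 1 / (2 * real n)))
      = 2 / (pi * real n) * (\<alpha>\<^sup>2 * real n + \<alpha>\<^sup>2 / 2)"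
    using dim by (simp add: field_simps)
  ultimately show ?thesis by simp
qed

lemma mean_square_abs_marginal_upper:
  "(\<integral>\<theta>. (abs_marginal \<theta>)\<^sup>2 \<partial>sphere_measure n) \<le> 2 / (pi * real n) * (\<alpha>\<^sup>2 * real n + \<alpha>\<^sup>2 / 2
    + (\<integral>x. (\<integral>y. (vinner n x y) ^ 4 / ((vnorm n x) ^ 3 * (vnorm n y) ^ 3) \<partial>\<mu>) \<partial>\<mu>))"
proof -
  let ?N = "\<lambda>(x, y). vnorm n x * vnorm n y"
  let ?Q = "\<lambda>(x, y). (vinner n x y)\<^sup>2 / (vnorm n x * vnorm n y)"
  let ?R = "\<lambda>(x, y). (vinner n x y) ^ 4 / ((vnorm n x) ^ 3 * (vnorm n y) ^ 3)"
  note N = pair_sigma_finite.integrable_pair_mult[OF pair_mu_mu integrable_vnorm integrable_vnorm]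
  note ints = N integrable_pair_square integrable_pair_quartic
  have "(\<integral>\<theta>. (abs_marginal \<theta>)\<^sup>2 \<partial>sphere_measure n) =
      (\<integral>p. (\<integral>\<theta>. \<bar>vinner n (fst p) \<theta>\<bar> * \<bar>vinner n (snd p) \<theta>\<bar> \<partial>sphere_measure n) \<partial>(\<mu> \<Otimes>\<^sub>M \<mu>))"
    unfolding abs_marginal_square by (rule pair_sigma_finite.Fubini_integral[OF pair_sphere_mu_mu integrable_abs_marginal_square_kernel, symmetric])
  also have "\<dots> \<le> (\<integral>p. 2 / (pi * real n) * (?N p + ?Q p / 2 + ?R p) \<partial>(\<mu> \<Otimes>\<^sub>M \<mu>))"
  proof (rule integral_mono)
    show "integrable (\<mu> \<Otimes>\<^sub>M \<mu>)
        (\<lambda>p. \<integral>\<theta>. \<bar>vinner n (fst p) \<theta>\<bar> * \<bar>vinner n (snd p) \<theta>\<bar> \<partial>sphere_measure n)"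
      using pair_sigma_finite.integrable_snd[OF pair_sphere_mu_mu integrable_abs_marginal_square_kernel] .
    show "integrable (\<mu> \<Otimes>\<^sub>M \<mu>) (\<lambda>p. 2 / (pi * real n) * (?N p + ?Q p / 2 + ?R p))"
      by (intro integrable_mult_right Bochner_Integration.integrable_add integrable_divide ints)
  qed (use sphere_integral_abs_product_le[OF dim] in \<open>simp add: case_prod_unfold\<close>)
  also have "\<dots> = 2 / (pi * real n) * (integral\<^sup>L (\<mu> \<Otimes>\<^sub>M \<mu>) ?N + integral\<^sup>L (\<mu> \<Otimes>\<^sub>M \<mu>) ?Q / 2
      + integral\<^sup>L (\<mu> \<Otimes>\<^sub>M \<mu>) ?R)"
    using ints by simp
  also have "integral\<^sup>L (\<mu> \<Otimes>\<^sub>M \<mu>) ?N = \<alpha>\<^sup>2 * real n"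
    unfolding pair_sigma_finite.integral_pair_mult[OF pair_mu_mu integrable_vnorm integrable_vnorm]
    by (simp add: integral_vnorm power2_eq_square mult_ac flip: real_sqrt_mult)
  also have "integral\<^sup>L (\<mu> \<Otimes>\<^sub>M \<mu>) ?Q = \<alpha>\<^sup>2" by (rule integral_pair_square)
  also have "integral\<^sup>L (\<mu> \<Otimes>\<^sub>M \<mu>) ?R =
      (\<integral>x. (\<integral>y. (vinner n x y) ^ 4 / ((vnorm n x) ^ 3 * (vnorm n y) ^ 3) \<partial>\<mu>) \<partial>\<mu>)"
    using pair_sigma_finite.integral_fst'[OF pair_mu_mu integrable_pair_quartic] by simp
  finally show ?thesis .
qed

text \<open>The constant and quadratic parts of the two bounds above coincide, so their difference consists
  of the quartic term alone.\<close>

lemma variance_Fmu_le: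
  "prob_space.variance (sphere_measure n) (Fmu n \<mu>)
    \<le> (\<integral>x. (\<integral>y. (vinner n x y) ^ 4 / ((vnorm n x) ^ 3 * (vnorm n y) ^ 3) \<partial>\<mu>) \<partial>\<mu>) / (2 * pi * real n)"
proof -
  define R where
    "R = (\<integral>x. (\<integral>y. (vinner n x y) ^ 4 / ((vnorm n x) ^ 3 * (vnorm n y) ^ 3) \<partial>\<mu>) \<partial>\<mu>)"
  have F: "Fmu n \<mu> = (\<lambda>\<theta>. abs_marginal \<theta> / 2)" by (simp add: Fmu_eq_abs_marginal fun_eq_iff)
  have "prob_space.variance (sphere_measure n) (Fmu n \<mu>)
      = (\<integral>\<theta>. (abs_marginal \<theta> / 2)\<^sup>2 \<partial>sphere_measure n) - (\<integral>\<theta>. abs_marginal \<theta> / 2 \<partial>sphere_measure n)\<^sup>2"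
    unfolding F using integrable_abs_marginal integrable_abs_marginal_square
    by (intro prob_space.variance_eq[OF prob_space_sphere_measure]) (auto simp: power_divide)
  also have "\<dots> = ((\<integral>\<theta>. (abs_marginal \<theta>)\<^sup>2 \<partial>sphere_measure n) - (\<integral>\<theta>. abs_marginal \<theta> \<partial>sphere_measure n)\<^sup>2) / 4"
    by (simp add: power_divide)
  also have "\<dots> \<le> (2 / (pi * real n) * R) / 4"
    using mean_square_abs_marginal_upper mean_abs_marginal_square_lower
    unfolding R_def[symmetric] distrib_left[of _ _ R] by simp
  also have "\<dots> = R / (2 * pi * real n)" by simp
  finally show ?thesis unfolding R_def .
qed

end

theorem theorem1:
  shows "\<exists>C::real. C > 0 \<and>
    (\<forall>(n::nat) (\<mu>::(nat \<Rightarrow> real) measure) (\<alpha>::real) (\<beta>::real).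
      n \<ge> 1 \<longrightarrow> borel_prob n \<mu> \<longrightarrow> centered n \<mu> \<longrightarrow> \<alpha> > 0 \<longrightarrow> \<beta> > 0 \<longrightarrow>
      (\<forall>i<n. \<forall>j<n. Cov1 n \<mu> i j = \<alpha> / sqrt (real n) * (if i = j then 1 else 0)) \<longrightarrow>
      (\<integral>x. (\<integral>y. (vinner n x y) ^ 4 / ((vnorm n x) ^ 3 * (vnorm n y) ^ 3) \<partial>\<mu>) \<partial>\<mu>)
        \<le> \<beta> * \<alpha>\<^sup>2 / real n \<longrightarrow>
      prob_space.variance (sphere_measure n) (Fmu n \<mu>) \<le> C * (1 + \<beta>) * \<alpha>\<^sup>2 / (real n)\<^sup>2)"
proof (intro exI[of _ "1 / (2 * pi)"] conjI allI impI)
  fix n \<mu> and \<alpha> \<beta> :: real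
  assume *: "n \<ge> 1" "borel_prob n \<mu>" "centered n \<mu>" "\<alpha> > 0" "\<beta> > 0"
    "\<forall>i<n. \<forall>j<n. Cov1 n \<mu> i j = \<alpha> / sqrt (real n) * (if i = j then 1 else 0)"
    and quartic: "(\<integral>x. (\<integral>y. (vinner n x y) ^ 4 / ((vnorm n x) ^ 3 * (vnorm n y) ^ 3) \<partial>\<mu>) \<partial>\<mu>)
        \<le> \<beta> * \<alpha>\<^sup>2 / real n"
  then interpret isotropic_measure n \<mu> \<alpha> by unfold_locales auto
  have "prob_space.variance (sphere_measure n) (Fmu n \<mu>) \<le> (\<beta> * \<alpha>\<^sup>2 / real n) / (2 * pi * real n)"
    using quartic by (intro order.trans[OF variance_Fmu_le] divide_right_mono) auto
  also have "\<dots> = 1 / (2 * pi) * \<beta> * \<alpha>\<^sup>2 / (real n)\<^sup>2"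
    by (simp add: power2_eq_square)
  also have "\<dots> \<le> 1 / (2 * pi) * (1 + \<beta>) * \<alpha>\<^sup>2 / (real n)\<^sup>2"
    by (intro divide_right_mono mult_right_mono mult_left_mono) auto
  finally show "prob_space.variance (sphere_measure n) (Fmu n \<mu>)
      \<le> 1 / (2 * pi) * (1 + \<beta>) * \<alpha>\<^sup>2 / (real n)\<^sup>2" .
qed simp

end
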